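(* Let $\mathcal{G}_{n,n+1}$ denote the set of connected simple graphs with $n$ vertices and $n+1$ edges. If $n=4$ or $n\geq 8$, then $S_{n,n+1}$ has minimal energy in $\mathcal{G}_{n,n+1}$; if $5\leq n\leq 7$, then $B_{n,n+1}$ has minimal energy in $\mathcal{G}_{n,n+1}$.
   Context: All graphs are finite and simple. The energy of a graph $G$ is $E(G)=\sum_{i=1}^n|\lambda_i|$, where $\lambda_1,\dots,\lambda_n$ are the eigenvalues of the adjacency matrix of $G$. For $n-1\le e$, $S_{n,e}$ is the graph obtained from the star $S_n$ on $n$ vertices (center $v$) by adding $e-n+1$ edges among the leaves, all incident to one common leaf $u$; i.e. $v$ is adjacent to all other vertices and $u$ is additionally adjacent to $e-n+1$ further leaves. $B_{n,e}$ denotes the connected bipartite graph with $n$ vertices and $e$ edges having two vertices $a,b$ on one side and $n-2$ vertices on the other side, where $a$ is adjacent to all $n-2$ vertices of the other side (so $b$ is adjacent to $e-n+2$ of them). *)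

theory Defs
  imports
    "Graph_Theory.Pair_Digraph"
    "Graph_Theory.Digraph_Component"
    "Jordan_Normal_Form.Char_Poly"
begin

text \<open>
  A simple graph is a \<^locale>\<open>pair_graph\<close>: a finite symmetric loop-free relation, each edge
  being represented by two opposite arcs. Hence edges are counted as unordered pairs.
\<close>

definition edge_set :: "'a pair_pre_digraph \<Rightarrow> 'a set set" where
  "edge_set G = (\<lambda>(x, y). {x, y}) ` parcs G"

definition connected_graphs :: "nat \<Rightarrow> nat \<Rightarrow> 'a pair_pre_digraph set" where
  "connected_graphs n e =
     {G. pair_graph G \<and> Digraph_Component.connected (with_proj G) \<and> card (pverts G) = n \<and> card (edge_set G) = e}"

definition adjacency_matrix :: "'a pair_pre_digraph \<Rightarrow> 'a list \<Rightarrow> complex mat" where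
  "adjacency_matrix G vs = mat (length vs) (length vs)
     (\<lambda>(i, j). if (vs ! i, vs ! j) \<in> parcs G then 1 else 0)"

text \<open>
  The eigenvalues are the complex roots of the characteristic polynomial, with multiplicity.
  The energy does not depend on the chosen ordering of the vertices, see \<open>energy_eq\<close> below.
\<close>

definition energy :: "'a pair_pre_digraph \<Rightarrow> real" where
  "energy G = (\<Sum>\<mu>\<in># proots (char_poly (adjacency_matrix G
     (SOME vs. distinct vs \<and> set vs = pverts G))). cmod \<mu>)"

lemma adjacency_matrix_similar:
  assumes "distinct vs" "distinct ws" "set vs = set ws"
  shows "similar_mat (adjacency_matrix G vs) (adjacency_matrix G ws)"
proof -
  define n where "n = length vs"
  have len: "length ws = n" using assms distinct_card n_def by metis
  define P :: "complex mat" where "P = mat n n (\<lambda>(i, j). if vs ! i = ws ! j then 1 else 0)"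
  define Q :: "complex mat" where "Q = mat n n (\<lambda>(i, j). if ws ! i = vs ! j then 1 else 0)"
  have pick: "(\<Sum>k = 0..<n. (if us ! k = x then f (us ! k) else 0)) = f x"
    if "distinct us" "length us = n" "x \<in> set us" for f :: "_ \<Rightarrow> complex" and us x
  proof -
    have "(\<Sum>k = 0..<n. (if us ! k = x then f (us ! k) else 0))
        = sum_list (map (\<lambda>y. if y = x then f y else 0) us)"
      using that(2) by (simp add: sum_list_sum_nth)
    also have "\<dots> = (\<Sum>y\<in>set us. if y = x then f y else 0)"
      using that(1) by (simp add: sum_list_distinct_conv_sum_set)
    also have "\<dots> = f x" using that(3) by (simp add: sum.delta)
    finally show ?thesis .
  qed
  have mv: "vs ! i \<in> set vs" "vs ! i \<in> set ws" "ws ! i \<in> set vs" "ws ! i \<in> set ws" if "i < n" for i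
    using that assms(3) len n_def by (metis nth_mem)+
  have inj: "vs ! i = vs ! j \<longleftrightarrow> i = j" "ws ! i = ws ! j \<longleftrightarrow> i = j" if "i < n" "j < n" for i j
    using that assms(1,2) len n_def by (auto simp: nth_eq_iff_index_eq)
  have PQ: "P * Q = 1\<^sub>m n"
  proof (rule eq_matI)
    fix i j assume "i < dim_row (1\<^sub>m n)" "j < dim_col (1\<^sub>m n)"
    then have ij: "i < n" "j < n" by auto
    have "(P * Q) $$ (i, j) = (\<Sum>k = 0..<n. (if ws ! k = vs ! i then (if ws ! k = vs ! j then 1 else 0) else 0))"
      using ij by (auto simp: P_def Q_def scalar_prod_def intro!: sum.cong)
    also have "\<dots> = (if vs ! i = vs ! j then 1 else 0)"
      by (rule pick) (use assms len mv ij in auto)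
    finally show "(P * Q) $$ (i, j) = 1\<^sub>m n $$ (i, j)" using ij inj by simp
  qed (auto simp: P_def Q_def)
  have QP: "Q * P = 1\<^sub>m n"
  proof (rule eq_matI)
    fix i j assume "i < dim_row (1\<^sub>m n)" "j < dim_col (1\<^sub>m n)"
    then have ij: "i < n" "j < n" by auto
    have "(Q * P) $$ (i, j) = (\<Sum>k = 0..<n. (if vs ! k = ws ! i then (if vs ! k = ws ! j then 1 else 0) else 0))"
      using ij by (auto simp: P_def Q_def scalar_prod_def intro!: sum.cong)
    also have "\<dots> = (if ws ! i = ws ! j then 1 else 0)"
      by (rule pick) (use assms n_def mv ij in auto)
    finally show "(Q * P) $$ (i, j) = 1\<^sub>m n $$ (i, j)" using ij inj by simp
  qed (auto simp: P_def Q_def)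
  have eq: "P * adjacency_matrix G ws = adjacency_matrix G vs * P"
  proof (rule eq_matI)
    fix i j assume "i < dim_row (adjacency_matrix G vs * P)" "j < dim_col (adjacency_matrix G vs * P)"
    then have ij: "i < n" "j < n" by (auto simp: P_def adjacency_matrix_def n_def)
    have "(P * adjacency_matrix G ws) $$ (i, j)
      = (\<Sum>k = 0..<n. (if ws ! k = vs ! i then (if (ws ! k, ws ! j) \<in> parcs G then 1 else 0) else 0))"
      using ij len by (auto simp: P_def adjacency_matrix_def scalar_prod_def intro!: sum.cong)
    also have "\<dots> = (if (vs ! i, ws ! j) \<in> parcs G then 1 else 0)"
      by (rule pick) (use assms len mv ij in auto)
    also have "\<dots> = (\<Sum>k = 0..<n. (if vs ! k = ws ! j then (if (vs ! i, vs ! k) \<in> parcs G then 1 else 0) else 0))"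
      by (rule pick[symmetric]) (use assms n_def mv ij in auto)
    also have "\<dots> = (adjacency_matrix G vs * P) $$ (i, j)"
      using ij n_def by (auto simp: P_def adjacency_matrix_def scalar_prod_def intro!: sum.cong)
    finally show "(P * adjacency_matrix G ws) $$ (i, j) = (adjacency_matrix G vs * P) $$ (i, j)" .
  qed (auto simp: P_def adjacency_matrix_def len n_def)
  have car: "P \<in> carrier_mat n n" "Q \<in> carrier_mat n n"
    "adjacency_matrix G vs \<in> carrier_mat n n" "adjacency_matrix G ws \<in> carrier_mat n n"
    by (auto simp: P_def Q_def adjacency_matrix_def len n_def)
  have "P * adjacency_matrix G ws * Q = adjacency_matrix G vs * (P * Q)"
    unfolding eq using car by (simp add: assoc_mult_mat[of _ n n _ n _ n])
  also have "\<dots> = adjacency_matrix G vs" using car PQ by simp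
  finally have "adjacency_matrix G vs = P * adjacency_matrix G ws * Q" ..
  then have "similar_mat_wit (adjacency_matrix G vs) (adjacency_matrix G ws) P Q"
    using car PQ QP unfolding similar_mat_wit_def Let_def by auto
  then show ?thesis unfolding similar_mat_def by blast
qed

lemma energy_eq:
  assumes "distinct vs" "set vs = pverts G"
  shows "energy G = (\<Sum>\<mu>\<in># proots (char_poly (adjacency_matrix G vs)). cmod \<mu>)"
proof -
  define ws where "ws = (SOME ws. distinct ws \<and> set ws = pverts G)"
  have ws: "distinct ws \<and> set ws = pverts G"
    unfolding ws_def using assms by (intro someI) blast
  have "char_poly (adjacency_matrix G ws) = char_poly (adjacency_matrix G vs)"
    by (rule char_poly_similar, rule adjacency_matrix_similar) (use assms ws in auto)
  then show ?thesis unfolding energy_def ws_def[symmetric] by simp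
qed

text \<open>
  Centre $v = 0$, distinguished leaf $u = 1$, and $u$ is joined to the $e - n + 1$ further leaves
  from 2 on. Meaningful for $n - 1 \<le> e \<le> 2n - 3$ and $n \<ge> 2$.
\<close>

definition S_graph :: "nat \<Rightarrow> nat \<Rightarrow> nat pair_pre_digraph" where
  "S_graph n e =
     (let E = {0} \<times> {1..<n} \<union> {1} \<times> {2..<2 + (e + 1 - n)}
      in \<lparr>pverts = {0..<n}, parcs = E \<union> E\<inverse>\<rparr>)"

text \<open>
  Here $a = 0$ and $b = 1$ form one side, the vertices from 2 on the other one, and $b$ is joined
  to $e - n + 2$ of them. Meaningful for $n - 1 \<le> e \<le> 2(n - 2)$ and $n \<ge> 3$.
\<close>

definition B_graph :: "nat \<Rightarrow> nat \<Rightarrow> nat pair_pre_digraph" where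
  "B_graph n e =
     (let E = {0} \<times> {2..<n} \<union> {1} \<times> {2..<2 + (e + 2 - n)}
      in \<lparr>pverts = {0..<n}, parcs = E \<union> E\<inverse>\<rparr>)"

end

theory Submission
  imports Defs "Jordan_Normal_Form.Schur_Decomposition"
begin

text \<open>
  Let \<open>s\<close> be half the energy of a graph with \<open>m\<close> edges, \<open>P\<close> and \<open>Q\<close> the second elementary symmetric
  sums of its positive and of the absolute values of its negative eigenvalues. Then \<open>s\<^sup>2 - m = P + Q\<close>,
  and Newton's identities give \<open>(s\<^sup>2 - m)\<^sup>2 \<ge> 4 b\<^sub>4\<close>, where \<open>4 b\<^sub>4 = 2 m\<^sup>2 - tr A\<^sup>4\<close>. With at least
  two triangles this improves to \<open>4 b\<^sub>4 + 16 / s\<^sup>2\<close>. The two extremal graphs have at most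
  two positive and two negative eigenvalues; this makes the second bound an equality for \<open>S\<close>, where
  \<open>b\<^sub>4 = 2n - 8\<close>, and the first one for the bipartite \<open>B\<close>, where \<open>b\<^sub>4 = 3n - 15\<close>. As \<open>16 / s\<^sup>2 < 4\<close> and \<open>b\<^sub>4\<close> is an integer,
  minimality only needs lower bounds on \<open>b\<^sub>4\<close>. Attaching a pendant vertex to \<open>y\<close> increases \<open>b\<^sub>4\<close>
  by the number of edges avoiding \<open>y\<close>, which is at least 2, and at least 3 unless \<open>y\<close> is dominating;
  this reduces the bounds to minimum degree 2, where the degrees are \<open>4, 2, \<dots>, 2\<close> or \<open>3, 3, 2, \<dots>, 2\<close>.
\<close>

section \<open>Absolute sums of reals and power sums\<close>

definition psum :: "nat \<Rightarrow> real multiset \<Rightarrow> real" where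
  "psum k X = (\<Sum>x\<in>#X. x ^ k)"

lemma psum_simps [simp]:
  "psum k {#} = 0" "psum k (add_mset x X) = x ^ k + psum k X"
  "psum k (X + Y) = psum k X + psum k Y"
  by (simp_all add: psum_def)

lemma psum_nonneg: "(\<forall>x\<in>#X. 0 \<le> x) \<Longrightarrow> 0 \<le> psum k X"
  by (induction X) auto

text \<open>Let e_k be the elementary symmetric sums. The four differences are 2 e_2, the sum of
  x_i^2 x_j over i \<noteq> j, 6 e_3 and 2 (e_1 e_3 - 4 e_4), all of them sums of monomials with
  nonnegative coefficients. One induction proves them together because the step for the third uses
  the first, and that for the fourth uses the first two.\<close>

lemma psum_inequalities:
  assumes "\<forall>x\<in>#X. 0 \<le> x"
  shows "psum 2 X \<le> psum 1 X ^ 2"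
    and "psum 3 X \<le> psum 1 X * psum 2 X"
    and "3 * psum 1 X * psum 2 X \<le> 2 * psum 3 X + psum 1 X ^ 3"
    and "psum 2 X ^ 2 + 2 * psum 1 X * psum 3 X \<le> 2 * psum 4 X + psum 1 X ^ 2 * psum 2 X"
proof -
  have "psum 2 X \<le> psum 1 X ^ 2 \<and> psum 3 X \<le> psum 1 X * psum 2 X \<and>
    3 * psum 1 X * psum 2 X \<le> 2 * psum 3 X + psum 1 X ^ 3 \<and>
    psum 2 X ^ 2 + 2 * psum 1 X * psum 3 X \<le> 2 * psum 4 X + psum 1 X ^ 2 * psum 2 X"
    using assms
  proof (induction X)
    case (add y X)
    define s r c f where "s = psum 1 X" and "r = psum 2 X" and "c = psum 3 X" and "f = psum 4 X"
    have IH: "r \<le> s ^ 2" "c \<le> s * r" "3 * s * r \<le> 2 * c + s ^ 3"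
        "r ^ 2 + 2 * s * c \<le> 2 * f + s ^ 2 * r"
      using add by (auto simp: s_def r_def c_def f_def)
    have nn: "0 \<le> y" "0 \<le> s" "0 \<le> r"
      using add.prems unfolding s_def r_def by (auto intro!: psum_nonneg)
    have 1: "y ^ 2 + r \<le> (y + s) ^ 2"
      using IH(1) mult_nonneg_nonneg[OF nn(1,2)] by (simp add: power2_sum)
    have "(y + s) * (y ^ 2 + r) = y ^ 3 + s * r + y * r + s * y ^ 2"
      by (simp add: algebra_simps power2_eq_square power3_eq_cube)
    then have 2: "y ^ 3 + c \<le> (y + s) * (y ^ 2 + r)"
      using IH(2) mult_nonneg_nonneg[OF nn(1,3)] mult_nonneg_nonneg[OF nn(2) zero_le_power2[of y]]
      by linarith
    have "2 * (y ^ 3 + c) + (y + s) ^ 3 =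
        3 * (y + s) * (y ^ 2 + r) + (2 * c + s ^ 3 - 3 * s * r) + 3 * (y * (s ^ 2 - r))"
      by (simp add: algebra_simps power2_eq_square power3_eq_cube)
    then have 3: "3 * (y + s) * (y ^ 2 + r) \<le> 2 * (y ^ 3 + c) + (y + s) ^ 3"
      using IH(3) mult_nonneg_nonneg[OF nn(1), of "s ^ 2 - r"] IH(1) by linarith
    have "2 * (y ^ 4 + f) + (y + s) ^ 2 * (y ^ 2 + r) - (y ^ 2 + r) ^ 2 - 2 * (y + s) * (y ^ 3 + c)
        = (2 * f + s ^ 2 * r - r ^ 2 - 2 * s * c) + (2 * (y * (s * r - c)) + y * (y * (s ^ 2 - r)))"
      by (simp add: algebra_simps power2_eq_square power3_eq_cube power4_eq_xxxx)
    moreover have "0 \<le> 2 * (y * (s * r - c)) + y * (y * (s ^ 2 - r))"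
      using IH(1,2) nn by (intro add_nonneg_nonneg mult_nonneg_nonneg) auto
    ultimately have 4: "(y ^ 2 + r) ^ 2 + 2 * (y + s) * (y ^ 3 + c)
        \<le> 2 * (y ^ 4 + f) + (y + s) ^ 2 * (y ^ 2 + r)"
      using IH(4) by linarith
    from 1 2 3 4 show ?case
      by (simp add: s_def r_def c_def f_def)
  qed simp
  then show "psum 2 X \<le> psum 1 X ^ 2" "psum 3 X \<le> psum 1 X * psum 2 X"
    "3 * psum 1 X * psum 2 X \<le> 2 * psum 3 X + psum 1 X ^ 3"
    "psum 2 X ^ 2 + 2 * psum 1 X * psum 3 X \<le> 2 * psum 4 X + psum 1 X ^ 2 * psum 2 X"
    by auto
qed

lemma psum_split:
  fixes X :: "real multiset"
  obtains Y Z where "\<forall>x\<in>#Y. 0 \<le> x" "\<forall>x\<in>#Z. 0 \<le> x"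
    "\<And>k. psum k X = psum k Y + (-1) ^ k * psum k Z"
    "(\<Sum>x\<in>#X. \<bar>x\<bar>) = psum 1 Y + psum 1 Z"
proof -
  have "\<exists>Y Z. (\<forall>x\<in>#Y. 0 \<le> x) \<and> (\<forall>x\<in>#Z. 0 \<le> x) \<and>
    (\<forall>k. psum k X = psum k Y + (-1) ^ k * psum k Z) \<and>
    (\<Sum>x\<in>#X. \<bar>x\<bar>) = psum 1 Y + psum 1 Z"
  proof (induction X)
    case empty
    show ?case by (intro exI[of _ "{#}"]) auto
  next
    case (add x X)
    then obtain Y Z where YZ: "\<forall>x\<in>#Y. 0 \<le> x" "\<forall>x\<in>#Z. 0 \<le> x"
      "\<forall>k. psum k X = psum k Y + (-1) ^ k * psum k Z"
      "(\<Sum>x\<in>#X. \<bar>x\<bar>) = psum 1 Y + psum 1 Z" by blast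
    show ?case
    proof (cases "0 \<le> x")
      case True
      with YZ show ?thesis by (intro exI[of _ "add_mset x Y"] exI[of _ Z]) auto
    next
      case False
      have "x ^ k = (-1) ^ k * (- x) ^ k" for k
        by (simp flip: power_mult_distrib)
      with YZ False show ?thesis
        by (intro exI[of _ Y] exI[of _ "add_mset (- x) Z"]) (auto simp: algebra_simps)
    qed
  qed
  then show thesis using that by blast
qed

text \<open>As the sum vanishes, the two halves of \<open>X\<close> have the same sum
  \<open>s\<close>, and s^2 - m = P + Q. The threshold 12 stands for two triangles, each of which is
  counted six times in tr A^3. This asymmetry forces P and Q apart unless a third symmetric sum is
  positive, and either effect improves the bound.\<close>

lemma abs_sum_lower_bounds:
  fixes X :: "real multiset" and m :: real
  defines "s \<equiv> (\<Sum>x\<in>#X. \<bar>x\<bar>) / 2"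
  assumes sum0: "psum 1 X = 0" and sum2: "psum 2 X = 2 * m"
  shows "m \<le> s ^ 2"
    and "2 * m ^ 2 - psum 4 X \<le> (s ^ 2 - m) ^ 2"
    and "12 \<le> psum 3 X \<Longrightarrow> 8 \<le> 3 * s ^ 3 \<Longrightarrow>
      2 * m ^ 2 - psum 4 X + 16 / s ^ 2 \<le> (s ^ 2 - m) ^ 2"
proof -
  obtain Y Z where nn: "\<forall>x\<in>#Y. 0 \<le> x" "\<forall>x\<in>#Z. 0 \<le> x"
    and p: "\<And>k. psum k X = psum k Y + (-1) ^ k * psum k Z"
    and abs: "(\<Sum>x\<in>#X. \<bar>x\<bar>) = psum 1 Y + psum 1 Z"
    using psum_split[of X] by metis
  have sY: "psum 1 Y = s" and sZ: "psum 1 Z = s"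
    using p[of 1] sum0 abs unfolding s_def by auto
  have s0: "0 \<le> s" using psum_nonneg[OF nn(1), of 1] sY by simp
  define r1 r2 c1 c2 f1 f2 where defs: "r1 = psum 2 Y" "r2 = psum 2 Z" "c1 = psum 3 Y" "c2 = psum 3 Z"
    "f1 = psum 4 Y" "f2 = psum 4 Z"
  note iY = psum_inequalities[OF nn(1), unfolded sY, folded defs]
  note iZ = psum_inequalities[OF nn(2), unfolded sZ, folded defs]
  have r: "r1 + r2 = 2 * m" and c: "psum 3 X = c1 - c2" and f: "psum 4 X = f1 + f2"
    using p[of 2] p[of 3] p[of 4] sum2 by (simp_all add: defs)
  show "m \<le> s ^ 2" using iY(1) iZ(1) r by simp
  (* P, Q and y1, y2 are the second and third elementary symmetric sums of the two halves. *)
  define D y1 y2 where "D = (r2 - r1) / 2" and "y1 = c1 / 3 + s ^ 3 / 6 - s * r1 / 2"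
    and "y2 = c2 / 3 + s ^ 3 / 6 - s * r2 / 2"
  have y: "0 \<le> y1" "0 \<le> y2" using iY(3) iZ(3) unfolding y1_def y2_def by auto
  have rr: "r1 = m - D" "r2 = m + D" using r by (simp_all add: D_def field_simps)
  have "2 * (s * c1) = 6 * (s * y1) - s ^ 4 + 3 * s ^ 2 * r1"
       "2 * (s * c2) = 6 * (s * y2) - s ^ 4 + 3 * s ^ 2 * r2"
    by (simp_all add: y1_def y2_def algebra_simps power2_eq_square power3_eq_cube power4_eq_xxxx)
  then have "r1 ^ 2 + r2 ^ 2 + 6 * (s * y1) + 6 * (s * y2) + 2 * s ^ 2 * (r1 + r2) - 2 * s ^ 4 \<le> 2 * (f1 + f2)"
    using iY(4) iZ(4) by (simp add: algebra_simps)
  \<comment> \<open>Here D = P - Q. Adding the fourth inequality for both halves, with the cubic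
    power sums eliminated in favour of \<open>y1\<close> and \<open>y2\<close>, bounds 4 P Q = (P +
    Q)^2 - D^2 from below.\<close>
  then have main: "2 * m ^ 2 - psum 4 X + D ^ 2 + 3 * (s * (y1 + y2)) \<le> (s ^ 2 - m) ^ 2"
    unfolding f rr by (simp add: power2_eq_square power4_eq_xxxx algebra_simps)
  have "0 \<le> s * (y1 + y2)" using s0 y by simp
  with main show "2 * m ^ 2 - psum 4 X \<le> (s ^ 2 - m) ^ 2"
    using zero_le_power2[of D] by linarith
  assume t: "12 \<le> psum 3 X" and s3: "8 \<le> 3 * s ^ 3"
  have sp: "0 < s" using s3 s0 by (cases "s = 0") auto
  have eq: "3 * (y1 - y2) = psum 3 X + 3 * (s * D)"
    unfolding c y1_def y2_def D_def by (simp add: algebra_simps add_divide_distrib diff_divide_distrib)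
  define u where "u = y1 + y2"
  have u0: "0 \<le> u" using y by (simp add: u_def)
  have le: "s * D \<le> u - 4" using eq t y unfolding u_def by argo
  \<comment> \<open>For u \<le> 4 both sides of \<open>le\<close> are nonpositive, so it can be
    squared; dropping u^2 leaves a bound linear in \<open>u\<close>, which is trivial for u >
    4.\<close>
  have sq: "16 - 8 * u \<le> (s * D) ^ 2"
  proof (cases "u \<le> 4")
    case True
    then have "(4 - u) ^ 2 \<le> (- (s * D)) ^ 2" using le by (intro power_mono) linarith+
    then have "16 - 8 * u + u ^ 2 \<le> (s * D) ^ 2" by (simp add: power2_diff)
    then show ?thesis using zero_le_power2[of u] by linarith
  next
    case False
    then show ?thesis using zero_le_power2[of "s * D"] by linarith
  qed
  \<comment> \<open>After multiplication by s^2 the term in \<open>u\<close> of \<open>main\<close>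
    has the coefficient 3 s^3, which pays for the loss of 8 u in \<open>sq\<close>.\<close>
  have "8 * u \<le> 3 * s ^ 3 * u" using s3 u0 by (rule mult_right_mono)
  then have "16 \<le> (s * D) ^ 2 + 3 * s ^ 3 * u" using sq by linarith
  also have "\<dots> = (D ^ 2 + 3 * (s * u)) * s ^ 2"
    by (simp add: algebra_simps power2_eq_square power3_eq_cube)
  finally have "16 / s ^ 2 \<le> D ^ 2 + 3 * (s * u)"
    using sp by (simp add: divide_le_eq)
  with main show "2 * m ^ 2 - psum 4 X + 16 / s ^ 2 \<le> (s ^ 2 - m) ^ 2"
    unfolding u_def by linarith
qed

section \<open>Traces and characteristic polynomials\<close>

definition mat_trace :: "'a :: comm_ring_1 mat \<Rightarrow> 'a" where
  "mat_trace A = (\<Sum>i<dim_row A. A $$ (i, i))"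

lemma mat_trace_mult_comm:
  fixes A B :: "'a :: comm_ring_1 mat"
  assumes "A \<in> carrier_mat n m" "B \<in> carrier_mat m n"
  shows "mat_trace (A * B) = mat_trace (B * A)"
proof -
  have "mat_trace (A * B) = (\<Sum>i<n. \<Sum>j<m. A $$ (i, j) * B $$ (j, i))"
    using assms by (auto simp: mat_trace_def scalar_prod_def atLeast0LessThan intro!: sum.cong)
  also have "\<dots> = (\<Sum>j<m. \<Sum>i<n. B $$ (j, i) * A $$ (i, j))"
    by (subst sum.swap) (simp add: mult.commute)
  also have "\<dots> = mat_trace (B * A)"
    using assms by (auto simp: mat_trace_def scalar_prod_def atLeast0LessThan intro!: sum.cong)
  finally show ?thesis .
qed

lemma upper_triangular_mult:
  fixes A B :: "'a :: comm_ring_1 mat"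
  assumes A: "A \<in> carrier_mat n n" and B: "B \<in> carrier_mat n n"
    and ut: "upper_triangular A" "upper_triangular B"
  shows "upper_triangular (A * B)"
    and "i < n \<Longrightarrow> (A * B) $$ (i, i) = A $$ (i, i) * B $$ (i, i)"
proof -
  have 0: "A $$ (i, k) = 0" "B $$ (i, k) = 0" if "k < i" "i < n" for i k
    using ut A B that by auto
  have entry: "(A * B) $$ (i, j) = (\<Sum>k\<in>{0..<n}. A $$ (i, k) * B $$ (k, j))"
    if "i < n" "j < n" for i j
    using A B that by (auto simp: scalar_prod_def)
  show "upper_triangular (A * B)"
  proof (rule upper_triangularI)
    fix i j assume "j < i" "i < dim_row (A * B)"
    then have ij: "j < i" "i < n" using A by auto
    have "A $$ (i, k) * B $$ (k, j) = 0" if "k < n" for k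
      using 0[of k i] 0[of j k] ij that by (cases "k < i") auto
    then show "(A * B) $$ (i, j) = 0"
      using entry[of i j] ij by simp
  qed
  assume i: "i < n"
  have "A $$ (i, k) * B $$ (k, i) = (if k = i then A $$ (i, i) * B $$ (i, i) else 0)" if "k < n" for k
    using 0[of k i] 0[of i k] i that by (cases k i rule: linorder_cases) auto
  then have "(\<Sum>k\<in>{0..<n}. A $$ (i, k) * B $$ (k, i))
      = (\<Sum>k\<in>{0..<n}. if k = i then A $$ (i, i) * B $$ (i, i) else 0)"
    by (intro sum.cong) auto
  then show "(A * B) $$ (i, i) = A $$ (i, i) * B $$ (i, i)"
    using entry[OF i i] i by simp
qed

lemma upper_triangular_pow:
  fixes A :: "'a :: comm_ring_1 mat"
  assumes "A \<in> carrier_mat n n" "upper_triangular A"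
  shows "upper_triangular (A ^\<^sub>m k) \<and> (\<forall>i<n. (A ^\<^sub>m k) $$ (i, i) = A $$ (i, i) ^ k)"
proof (induction k)
  case 0
  show ?case using assms by auto
next
  case (Suc k)
  then show ?case
    using upper_triangular_mult[OF pow_carrier_mat[OF assms(1), of k] assms(1) _ assms(2)]
    by (auto simp: mult.commute)
qed

lemma proots_prod_linear_factors:
  "proots (\<Prod>a\<leftarrow>as. [:- a, 1:]) = (mset as :: 'a :: field multiset)"
proof (induction as)
  case (Cons a as)
  have "(\<Prod>a\<leftarrow>as. [:- a, 1:]) \<noteq> 0" by (auto simp: prod_list_zero_iff)
  then show ?case using Cons by (simp add: proots_mult del: mult_pCons_left)
qed simp

text \<open>Schur triangularization puts the eigenvalues, with multiplicity, on the diagonal of a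
  triangular matrix, whose powers have the powers of these entries as diagonal. Cyclicity of the
  trace removes the conjugating matrices.\<close>

lemma mat_trace_pow_eq_sum_proots:
  fixes A :: "complex mat"
  assumes A: "A \<in> carrier_mat n n"
  shows "mat_trace (A ^\<^sub>m k) = (\<Sum>\<mu>\<in>#proots (char_poly A). \<mu> ^ k)"
proof -
  obtain as where "char_poly A = (\<Prod>a\<leftarrow>as. [:- a, 1:])"
    using char_poly_factorized[OF A] by blast
  then obtain B where B: "B \<in> carrier_mat n n" "upper_triangular B" and sim: "similar_mat A B"
    using schur_decomposition_exists[OF A] by blast
  obtain P Q where wit: "similar_mat_wit A B P Q"
    using sim unfolding similar_mat_def by blast
  note PQ = similar_mat_witD2[OF A wit]
  have Bk: "B ^\<^sub>m k \<in> carrier_mat n n" using B(1) by simp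
  have "mat_trace (A ^\<^sub>m k) = mat_trace ((P * B ^\<^sub>m k) * Q)"
    using similar_mat_wit_pow_id[OF wit] by simp
  also have "\<dots> = mat_trace (Q * (P * B ^\<^sub>m k))"
    using PQ Bk by (intro mat_trace_mult_comm) auto
  also have "Q * (P * B ^\<^sub>m k) = (Q * P) * B ^\<^sub>m k"
    by (rule assoc_mult_mat[symmetric, OF PQ(7,6) Bk])
  also have "\<dots> = B ^\<^sub>m k" using PQ Bk by simp
  also have "mat_trace \<dots> = (\<Sum>i<n. B $$ (i, i) ^ k)"
    using upper_triangular_pow[OF B, of k] B Bk by (auto simp: mat_trace_def)
  also have "\<dots> = (\<Sum>\<mu>\<leftarrow>diag_mat B. \<mu> ^ k)"
    using B(1) by (simp add: diag_mat_def sum_list_sum_nth atLeast0LessThan)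
  also have "\<dots> = (\<Sum>\<mu>\<in>#proots (char_poly A). \<mu> ^ k)"
    unfolding char_poly_similar[OF sim] char_poly_upper_triangular[OF B] proots_prod_linear_factors
    by (simp flip: sum_mset_sum_list)
  finally show ?thesis .
qed

text \<open>For an eigenvector v the quadratic form \<open>h\<close> is its own conjugate, and it
  equals \<mu> times the squared norm of v, which is nonzero.\<close>

lemma hermitian_proots_real:
  fixes A :: "complex mat"
  assumes A: "A \<in> carrier_mat n n" and herm: "\<And>i j. i < n \<Longrightarrow> j < n \<Longrightarrow> cnj (A $$ (i, j)) = A $$ (j, i)"
    and \<mu>: "\<mu> \<in># proots (char_poly A)"
  shows "\<mu> \<in> \<real>"
proof -
  have "char_poly A \<noteq> 0" using degree_monic_char_poly[OF A] by auto
  then have "eigenvalue A \<mu>"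
    using \<mu> by (simp add: eigenvalue_root_char_poly[OF A])
  then obtain v where v: "v \<in> carrier_vec n" "v \<noteq> 0\<^sub>v n" "A *\<^sub>v v = \<mu> \<cdot>\<^sub>v v"
    using A unfolding eigenvalue_def eigenvector_def by auto
  have row: "(\<Sum>j<n. A $$ (i, j) * v $ j) = \<mu> * v $ i" if "i < n" for i
  proof -
    have "(A *\<^sub>v v) $ i = (\<mu> \<cdot>\<^sub>v v) $ i" using v(3) by simp
    then show ?thesis using that A v(1) by (simp add: scalar_prod_def atLeast0LessThan)
  qed
  define h where "h = (\<Sum>i<n. \<Sum>j<n. cnj (v $ i) * A $$ (i, j) * v $ j)"
  have "cnj h = (\<Sum>i<n. \<Sum>j<n. v $ i * A $$ (j, i) * cnj (v $ j))"
    using herm by (simp add: h_def)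
  also have "\<dots> = h" unfolding h_def by (subst sum.swap) (simp add: mult_ac)
  finally have h: "h \<in> \<real>" by (simp add: Reals_cnj_iff)
  have "h = (\<Sum>i<n. cnj (v $ i) * (\<Sum>j<n. A $$ (i, j) * v $ j))"
    by (simp add: h_def sum_distrib_left mult.assoc)
  also have "\<dots> = (\<Sum>i<n. cnj (v $ i) * (\<mu> * v $ i))"
    by (intro sum.cong) (simp_all add: row)
  also have "\<dots> = (\<Sum>i<n. \<mu> * of_real (cmod (v $ i) ^ 2))"
    by (simp only: complex_norm_square mult_ac)
  also have "\<dots> = \<mu> * of_real (\<Sum>i<n. cmod (v $ i) ^ 2)"
    by (simp add: sum_distrib_left)
  finally have hm: "h = \<mu> * of_real (\<Sum>i<n. cmod (v $ i) ^ 2)" .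
  obtain i where i: "i < n" "v $ i \<noteq> 0" using v(1,2) by (metis carrier_vecD eq_vecI index_zero_vec)
  have "0 < (\<Sum>i<n. cmod (v $ i) ^ 2)"
    by (rule sum_pos2[of _ i]) (use i in auto)
  then have "of_real (\<Sum>i<n. cmod (v $ i) ^ 2) \<noteq> (0 :: complex)" by (simp only: of_real_eq_0_iff)
  then have "\<mu> = h / of_real (\<Sum>i<n. cmod (v $ i) ^ 2)"
    unfolding hm by (rule nonzero_mult_div_cancel_right[symmetric])
  then show ?thesis using h by (metis Reals_divide Reals_of_real)
qed

section \<open>Block matrices and the characteristic polynomials of U V and V U\<close>

lemma char_poly_lower_block:
  fixes A :: "'a :: idom mat"
  assumes A: "A \<in> carrier_mat n n" and B: "B \<in> carrier_mat m n" and C: "C \<in> carrier_mat m m"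
  shows "char_poly (four_block_mat A (0\<^sub>m n m) B C) = char_poly A * char_poly C"
proof -
  have "char_poly_matrix (four_block_mat A (0\<^sub>m n m) B C) =
      four_block_mat (char_poly_matrix A) (0\<^sub>m n m) (map_mat (\<lambda>a. [:- a:]) B) (char_poly_matrix C)"
    by (rule eq_matI) (use A B C in \<open>auto simp: char_poly_matrix_def\<close>)
  then show ?thesis
    unfolding char_poly_def using A B C
    by (simp add: det_four_block_mat_upper_right_zero[of _ n _ m])
qed

lemma char_poly_zero_mat: "char_poly (0\<^sub>m k k :: 'a :: idom mat) = [:0, 1:] ^ k"
proof -
  have "char_poly (0\<^sub>m k k :: 'a mat) = (\<Prod>a\<leftarrow>diag_mat (0\<^sub>m k k). [:- a, 1:])"
    by (rule char_poly_upper_triangular[of _ k]) auto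
  also have "diag_mat (0\<^sub>m k k :: 'a mat) = replicate k 0"
    by (rule nth_equalityI) (auto simp: diag_mat_def)
  finally show ?thesis by simp
qed

text \<open>Sylvester's identity: the block triangular matrices \<open>M1\<close> and
  \<open>M2\<close> are conjugate under the unipotent matrix \<open>S\<close> with inverse
  \<open>T\<close>, and their zero diagonal blocks contribute the powers of the variable.\<close>

lemma char_poly_mult_comm:
  fixes U V :: "'a :: idom mat"
  assumes U: "U \<in> carrier_mat n k" and V: "V \<in> carrier_mat k n"
  shows "[:0, 1:] ^ k * char_poly (U * V) = [:0, 1:] ^ n * char_poly (V * U)"
proof -
  define M1 where "M1 = four_block_mat (U * V) (0\<^sub>m n k) V (0\<^sub>m k k)"
  define M2 where "M2 = four_block_mat (0\<^sub>m n n) (0\<^sub>m n k) V (V * U)"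
  define S where "S = four_block_mat (1\<^sub>m n) U (0\<^sub>m k n) (1\<^sub>m k)"
  define T where "T = four_block_mat (1\<^sub>m n) (- U) (0\<^sub>m k n) (1\<^sub>m k)"
  have car: "M1 \<in> carrier_mat (n + k) (n + k)" "M2 \<in> carrier_mat (n + k) (n + k)"
      "S \<in> carrier_mat (n + k) (n + k)" "T \<in> carrier_mat (n + k) (n + k)"
    using U V by (auto simp: M1_def M2_def S_def T_def)
  have neg: "U + - U = 0\<^sub>m n k"
    using U by (intro eq_matI) auto
  have "S * T = four_block_mat (1\<^sub>m n * 1\<^sub>m n + U * 0\<^sub>m k n) (1\<^sub>m n * - U + U * 1\<^sub>m k)
      (0\<^sub>m k n * 1\<^sub>m n + 1\<^sub>m k * 0\<^sub>m k n) (0\<^sub>m k n * - U + 1\<^sub>m k * 1\<^sub>m k)"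
    unfolding S_def T_def using U by (intro mult_four_block_mat) auto
  also have "\<dots> = four_block_mat (1\<^sub>m n) (0\<^sub>m n k) (0\<^sub>m k n) (1\<^sub>m k)"
    using U by (intro cong_four_block_mat) auto
  finally have ST: "S * T = 1\<^sub>m (n + k)" unfolding four_block_one_mat .
  have "T * S = four_block_mat (1\<^sub>m n * 1\<^sub>m n + - U * 0\<^sub>m k n) (1\<^sub>m n * U + - U * 1\<^sub>m k)
      (0\<^sub>m k n * 1\<^sub>m n + 1\<^sub>m k * 0\<^sub>m k n) (0\<^sub>m k n * U + 1\<^sub>m k * 1\<^sub>m k)"
    unfolding S_def T_def using U by (intro mult_four_block_mat) auto
  also have "\<dots> = four_block_mat (1\<^sub>m n) (0\<^sub>m n k) (0\<^sub>m k n) (1\<^sub>m k)"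
    using U by (intro cong_four_block_mat) (auto simp: neg)
  finally have TS: "T * S = 1\<^sub>m (n + k)" unfolding four_block_one_mat .
  have "M1 * S = four_block_mat (U * V * 1\<^sub>m n + 0\<^sub>m n k * 0\<^sub>m k n) (U * V * U + 0\<^sub>m n k * 1\<^sub>m k)
      (V * 1\<^sub>m n + 0\<^sub>m k k * 0\<^sub>m k n) (V * U + 0\<^sub>m k k * 1\<^sub>m k)"
    unfolding M1_def S_def using U V by (intro mult_four_block_mat) auto
  also have "\<dots> = four_block_mat (1\<^sub>m n * 0\<^sub>m n n + U * V) (1\<^sub>m n * 0\<^sub>m n k + U * (V * U))
      (0\<^sub>m k n * 0\<^sub>m n n + 1\<^sub>m k * V) (0\<^sub>m k n * 0\<^sub>m n k + 1\<^sub>m k * (V * U))"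
    using U V by (intro cong_four_block_mat) auto
  also have "\<dots> = S * M2"
    unfolding M2_def S_def using U V by (intro mult_four_block_mat[symmetric]) auto
  finally have comm: "M1 * S = S * M2" .
  have "M1 = M1 * (S * T)" using car ST by simp
  also have "\<dots> = M1 * S * T"
    by (rule assoc_mult_mat[symmetric, OF car(1,3,4)])
  finally have "M1 = S * M2 * T" unfolding comm .
  then have "similar_mat M1 M2"
    using car ST TS by (intro similar_matI[of M1 M2 S T "n + k"]) auto
  then have "char_poly M1 = char_poly M2" by (rule char_poly_similar)
  moreover have "char_poly M1 = char_poly (U * V) * [:0, 1:] ^ k"
    unfolding M1_def using U V by (subst char_poly_lower_block) (auto simp: char_poly_zero_mat)
  moreover have "char_poly M2 = [:0, 1:] ^ n * char_poly (V * U)"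
    unfolding M2_def using U V by (subst char_poly_lower_block) (auto simp: char_poly_zero_mat)
  ultimately show ?thesis by (simp add: mult.commute)
qed

section \<open>Closed walks of length four in bicyclic graphs\<close>

text \<open>For symmetric \<open>R\<close> these are the entries of the squared adjacency
  matrix.\<close>

definition codeg :: "('a \<times> 'a) set \<Rightarrow> 'a \<Rightarrow> 'a \<Rightarrow> nat" where
  "codeg R i j = card (R `` {i} \<inter> R `` {j})"

text \<open>For a simple graph this is tr A^3, six times the number of triangles.\<close>

definition walks3 :: "'a set \<Rightarrow> ('a \<times> 'a) set \<Rightarrow> nat" where
  "walks3 V R = (\<Sum>i\<in>V. \<Sum>j\<in>R `` {i}. codeg R i j)"

text \<open>This is tr A^4, because A^2 is symmetric and its squared entries sum to the trace of its
  square.\<close>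

definition walks4 :: "'a set \<Rightarrow> ('a \<times> 'a) set \<Rightarrow> nat" where
  "walks4 V R = (\<Sum>i\<in>V. \<Sum>j\<in>V. codeg R i j ^ 2)"

text \<open>The cut form of connectivity suits the induction: the cut around a single vertex yields
  a neighbour, and cuts of the graph without a pendant vertex extend to the whole graph.\<close>

definition cut_connected :: "'a set \<Rightarrow> ('a \<times> 'a) set \<Rightarrow> bool" where
  "cut_connected V R \<longleftrightarrow> (\<forall>S. S \<noteq> {} \<longrightarrow> S \<subset> V \<longrightarrow> (\<exists>a\<in>S. \<exists>b\<in>V - S. (a, b) \<in> R))"

text \<open>
  With \<open>m = n + 1\<close> edges, \<open>2 m\<^sup>2 - walks4\<close> is four times the coefficient \<open>b\<^sub>4\<close> of the
  characteristic polynomial; the three alternatives say \<open>b\<^sub>4 \<ge> 2n - 8\<close> with two triangles,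
  \<open>b\<^sub>4 \<ge> 2n - 7\<close>, and \<open>b\<^sub>4 \<ge> 3n - 15\<close> without a dominating vertex. This disjunction is the
  invariant that survives attaching a pendant vertex.
\<close>

definition few_closed_walks :: "'a set \<Rightarrow> ('a \<times> 'a) set \<Rightarrow> bool" where
  "few_closed_walks V R \<longleftrightarrow>
     walks4 V R + 4 * card V \<le> 2 * card V ^ 2 + 34 \<and> 12 \<le> walks3 V R \<or>
     walks4 V R + 4 * card V \<le> 2 * card V ^ 2 + 30 \<or>
     5 \<le> card V \<and> walks4 V R + 8 * card V \<le> 2 * card V ^ 2 + 62 \<and> (\<forall>x\<in>V. card (R `` {x}) + 1 \<noteq> card V)"

section \<open>Degrees and codegrees of a finite graph\<close>

lemma sum_of_bool_mem:
  assumes "finite A"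
  shows "(\<Sum>x\<in>A. of_bool (x \<in> B)) = card (A \<inter> B)"
  using assms by (simp add: sum_of_bool_eq)

text \<open>A graph is a bare relation here, so that deleting a vertex stays within the locale.
  Every edge occurs in both directions, hence \<open>card R\<close> is twice the number of
  edges.\<close>

locale simple_rel =
  fixes V :: "'a set" and R :: "('a \<times> 'a) set"
  assumes finite_V: "finite V" and R_sub: "R \<subseteq> V \<times> V" and sym_R: "sym R" and irrefl_R: "irrefl R"
begin

abbreviation deg :: "'a \<Rightarrow> nat" where "deg x \<equiv> card (R `` {x})"

lemma R_symD: "(x, y) \<in> R \<Longrightarrow> (y, x) \<in> R"
  using sym_R by (auto dest: symD)

lemma not_refl: "(x, x) \<notin> R"
  using irrefl_R by (auto simp: irrefl_def)

lemma nbrs_sub: "R `` {x} \<subseteq> V - {x}"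
  using R_sub not_refl by auto

lemma finite_nbrs [simp]: "finite (R `` {x})"
  using nbrs_sub finite_V by (meson finite_Diff finite_subset)

lemma finite_R: "finite R"
  using R_sub finite_V by (meson finite_SigmaI finite_subset)

lemma deg_less: "x \<in> V \<Longrightarrow> deg x < card V"
  using nbrs_sub[of x] finite_V by (intro psubset_card_mono) auto

lemma sum_deg: "(\<Sum>x\<in>V. deg x) = card R"
proof -
  have "R = (SIGMA x:V. R `` {x})" using R_sub by auto
  then have "card R = card (SIGMA x:V. R `` {x})" by simp
  then show ?thesis using finite_V by (simp add: card_SigmaI)
qed

lemma codeg_refl [simp]: "codeg R x x = deg x"
  by (simp add: codeg_def)

lemma codeg_le: "codeg R x y \<le> deg x" "codeg R x y \<le> deg y"
  unfolding codeg_def by (auto intro!: card_mono)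

text \<open>Both sides count walks of length two, by their ends and by their middle vertex.\<close>

lemma sum_codeg: "(\<Sum>i\<in>V. \<Sum>j\<in>V. codeg R i j) = (\<Sum>k\<in>V. deg k ^ 2)"
proof -
  have c: "codeg R i j = (\<Sum>k\<in>V. of_bool ((k, i) \<in> R) * of_bool ((k, j) \<in> R))" for i j
  proof -
    have "R `` {i} \<inter> R `` {j} = {k \<in> V. (k, i) \<in> R \<and> (k, j) \<in> R}"
      using R_sub by (blast dest: R_symD)
    then have "codeg R i j = card (V \<inter> {k. (k, i) \<in> R \<and> (k, j) \<in> R})"
      unfolding codeg_def by (simp add: Int_def)
    also have "\<dots> = (\<Sum>k\<in>V. of_bool (k \<in> {k. (k, i) \<in> R \<and> (k, j) \<in> R}))"
      using finite_V by (rule sum_of_bool_mem[symmetric])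
    finally show ?thesis by (simp only: mem_Collect_eq of_bool_conj)
  qed
  have d: "deg k = (\<Sum>i\<in>V. of_bool ((k, i) \<in> R))" for k
  proof -
    have "R `` {k} = V \<inter> {i. (k, i) \<in> R}" using R_sub by auto
    then show ?thesis using sum_of_bool_mem[OF finite_V, of "{i. (k, i) \<in> R}"] by simp
  qed
  have "(\<Sum>i\<in>V. \<Sum>j\<in>V. codeg R i j) = (\<Sum>i\<in>V. \<Sum>k\<in>V. \<Sum>j\<in>V. of_bool ((k, i) \<in> R) * of_bool ((k, j) \<in> R))"
    unfolding c by (intro sum.cong refl sum.swap)
  also have "\<dots> = (\<Sum>k\<in>V. \<Sum>i\<in>V. \<Sum>j\<in>V. of_bool ((k, i) \<in> R) * of_bool ((k, j) \<in> R))"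
    by (rule sum.swap)
  also have "\<dots> = (\<Sum>k\<in>V. deg k ^ 2)"
    unfolding d power2_eq_square sum_product ..
  finally show ?thesis .
qed

text \<open>A linear bound on the squared off-diagonal codegrees reduces the count to degrees, since
  by \<open>sum_codeg\<close> the off-diagonal codegrees sum to the squared degrees minus
  \<open>card R\<close>. The term \<open>e\<close> absorbs exceptional pairs.\<close>

lemma walks4_le:
  assumes "\<And>i j. i \<in> V \<Longrightarrow> j \<in> V \<Longrightarrow> i \<noteq> j \<Longrightarrow> codeg R i j ^ 2 \<le> a * codeg R i j + e i j"
  shows "walks4 V R + a * card R \<le> (a + 1) * (\<Sum>x\<in>V. deg x ^ 2) + (\<Sum>i\<in>V. \<Sum>j\<in>V - {i}. e i j)"
proof -
  have "walks4 V R = (\<Sum>i\<in>V. deg i ^ 2 + (\<Sum>j\<in>V - {i}. codeg R i j ^ 2))"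
    unfolding walks4_def using finite_V by (intro sum.cong refl) (simp add: sum.remove)
  also have "\<dots> \<le> (\<Sum>i\<in>V. deg i ^ 2 + (\<Sum>j\<in>V - {i}. a * codeg R i j + e i j))"
    using assms by (intro sum_mono add_mono) auto
  also have "\<dots> = (\<Sum>x\<in>V. deg x ^ 2) + a * (\<Sum>i\<in>V. \<Sum>j\<in>V - {i}. codeg R i j) + (\<Sum>i\<in>V. \<Sum>j\<in>V - {i}. e i j)"
    by (simp add: sum.distrib sum_distrib_left)
  finally have 1: "walks4 V R \<le> \<dots>" .
  have "(\<Sum>k\<in>V. deg k ^ 2) = (\<Sum>i\<in>V. deg i + (\<Sum>j\<in>V - {i}. codeg R i j))"
    unfolding sum_codeg[symmetric] using finite_V by (intro sum.cong refl) (simp add: sum.remove)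
  also have "\<dots> = card R + (\<Sum>i\<in>V. \<Sum>j\<in>V - {i}. codeg R i j)"
    by (simp add: sum.distrib sum_deg)
  finally have "a * (\<Sum>k\<in>V. deg k ^ 2) = a * card R + a * (\<Sum>i\<in>V. \<Sum>j\<in>V - {i}. codeg R i j)"
    by (simp add: algebra_simps)
  with 1 show ?thesis by (simp add: algebra_simps)
qed

text \<open>The bound with a = 2 gives the third alternative as soon as there are six vertices. With
  five vertices \<open>u\<close> is dominating, which rules that alternative out, so the sharper a =
  1 is used to reach the second one.\<close>

lemma few_closed_walks_deg4:
  assumes R: "card R = 2 * card V + 2" and n: "4 \<le> card V"
    and u: "u \<in> V" "deg u = 4" and others: "\<And>x. x \<in> V \<Longrightarrow> x \<noteq> u \<Longrightarrow> deg x = 2"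
  shows "few_closed_walks V R"
proof -
  have n5: "5 \<le> card V" using deg_less[OF u(1)] u(2) by simp
  have "(\<Sum>x\<in>V. deg x ^ 2) = deg u ^ 2 + (\<Sum>x\<in>V - {u}. deg x ^ 2)"
    using u finite_V by (simp add: sum.remove)
  also have "(\<Sum>x\<in>V - {u}. deg x ^ 2) = (\<Sum>x\<in>V - {u}. 4)"
    using others by (intro sum.cong) auto
  finally have sq: "(\<Sum>x\<in>V. deg x ^ 2) = 4 * card V + 12"
    using u n finite_V by simp
  show ?thesis
  proof (cases "card V = 5")
    case True
    have "R `` {u} = V - {u}"
      using nbrs_sub[of u] u True finite_V by (intro card_subset_eq) auto
    then have dom: "(x, u) \<in> R" if "x \<in> V" "x \<noteq> u" for x using that R_symD[of u x] by auto
    \<comment> \<open>Two common neighbours of i and j would be \<open>u\<close> and some w, and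
      then w would have the three neighbours i, j and \<open>u\<close>.\<close>
    have small: "codeg R i j \<le> 1" if "i \<in> V" "j \<in> V" "i \<noteq> j" "j \<noteq> u" for i j
    proof (rule ccontr)
      assume "\<not> codeg R i j \<le> 1"
      then have c2: "codeg R i j = 2" using codeg_le(2)[of i j] others[of j] that by auto
      then have sub: "R `` {j} \<subseteq> R `` {i}"
        using card_subset_eq[of "R `` {j}" "R `` {i} \<inter> R `` {j}"] others[of j] that
        by (auto simp: codeg_def)
      have uj: "u \<in> R `` {j}" using dom that by auto
      then have iu: "i \<noteq> u" using sub not_refl by auto
      have "card (R `` {j} - {u}) = 1" using others[of j] that uj by simp
      then obtain w where "R `` {j} - {u} = {w}" by (auto simp: card_1_singleton_iff)
      then have w: "R `` {j} = {u, w}" "w \<noteq> u" using uj by blast+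
      have "w \<in> R `` {j}" "w \<in> R `` {i}" using w sub by auto
      then have "i \<in> R `` {w}" "j \<in> R `` {w}" and wV: "w \<in> V"
        using R_symD[of j w] R_symD[of i w] R_sub by auto
      moreover have "u \<in> R `` {w}" using dom w wV by auto
      ultimately have "card {i, j, u} \<le> deg w" by (intro card_mono) auto
      then show False using others[of w] w wV that iu by auto
    qed
    have le1: "codeg R i j \<le> 1" if "i \<in> V" "j \<in> V" "i \<noteq> j" for i j
    proof (cases "j = u")
      case True
      then show ?thesis using small[of j i] that by (simp add: codeg_def Int_commute)
    qed (use small that in auto)
    have "codeg R i j ^ 2 \<le> 1 * codeg R i j + 0" if "i \<in> V" "j \<in> V" "i \<noteq> j" for i j
      using le1[OF that] by (auto simp: le_Suc_eq)
    from walks4_le[OF this] show ?thesis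
      unfolding few_closed_walks_def using R True sq by simp
  next
    case False
    have "codeg R i j ^ 2 \<le> 2 * codeg R i j + 0" if "i \<in> V" "j \<in> V" "i \<noteq> j" for i j
    proof -
      have "codeg R i j \<le> 2" using that others[of i] others[of j] codeg_le[of i j] by (cases "i = u") auto
      then show ?thesis by (simp add: power2_eq_square)
    qed
    from walks4_le[OF this] have w: "walks4 V R \<le> 8 * card V + 32"
      using R sq by simp
    \<comment> \<open>This says 2 (n - 3) (n - 5) \<ge> 0 for n = \<open>card V\<close>.\<close>
    have "card V + 8 * card V + 7 * card V \<le> card V * card V + card V * card V + 30"
    proof -
      have "6 \<le> card V" using False n5 by simp
      then obtain k where "card V = 6 + k" using le_Suc_ex by blast
      then show ?thesis by (simp add: algebra_simps)
    qed
    moreover have "deg x + 1 \<noteq> card V" if "x \<in> V" for x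
      using u others[of x] that n5 False by (cases "x = u") auto
    ultimately show ?thesis
      unfolding few_closed_walks_def using w n5 by (simp add: power2_eq_square)
  qed
qed

text \<open>On four vertices the graph is K_4 minus an edge, which meets the first alternative with
  equality. From five vertices on there is no dominating vertex, and \<open>walks4_le\<close> with a
  = 2 gives the third.\<close>

lemma few_closed_walks_deg33:
  assumes R: "card R = 2 * card V + 2" and n: "4 \<le> card V"
    and uw: "u \<in> V" "w \<in> V" "u \<noteq> w" "deg u = 3" "deg w = 3"
    and others: "\<And>x. x \<in> V \<Longrightarrow> x \<noteq> u \<Longrightarrow> x \<noteq> w \<Longrightarrow> deg x = 2"
  shows "few_closed_walks V R"
proof (cases "card V = 4")
  case True
  have Nu: "R `` {u} = V - {u}" and Nw: "R `` {w} = V - {w}"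
    using nbrs_sub[of u] nbrs_sub[of w] uw True finite_V by (simp_all add: card_subset_eq)
  have "card (V - {u, w}) = 2" using uw True finite_V by (simp add: card_Diff_subset)
  then obtain x y where xy: "V - {u, w} = {x, y}" "x \<noteq> y" by (auto simp: card_2_iff)
  then have V: "V = {u, w, x, y}" using uw by auto
  have d: "x \<noteq> u" "x \<noteq> w" "y \<noteq> u" "y \<noteq> w" using xy by auto
  have Nz: "R `` {z} = {u, w}" if "z \<in> V" "z \<noteq> u" "z \<noteq> w" for z
  proof -
    have "{u, w} \<subseteq> R `` {z}" using Nu Nw that R_symD[of u z] R_symD[of w z] by auto
    then show ?thesis using card_subset_eq[of "R `` {z}" "{u, w}"] others[of z] that uw by auto
  qed
  have N: "R `` {u} = {w, x, y}" "R `` {w} = {u, x, y}" "R `` {x} = {u, w}" "R `` {y} = {u, w}"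
    using Nu Nw Nz[of x] Nz[of y] V uw xy d by auto
  have "codeg R u u = 3" "codeg R w w = 3" "codeg R x x = 2" "codeg R y y = 2"
      "codeg R u w = 2" "codeg R w u = 2" "codeg R x y = 2" "codeg R y x = 2"
      "codeg R u x = 1" "codeg R x u = 1" "codeg R u y = 1" "codeg R y u = 1"
      "codeg R w x = 1" "codeg R x w = 1" "codeg R w y = 1" "codeg R y w = 1"
    using uw(3) xy(2) d unfolding codeg_def N by (simp_all add: Int_insert_left)
  then have "walks4 V R = 50" and "walks3 V R = 12"
    unfolding walks4_def walks3_def V sum.insert using uw(3) xy(2) d by (simp_all add: N power2_eq_square del: Image_singleton_iff)
  then show ?thesis unfolding few_closed_walks_def using True by simp
next
  case False
  \<comment> \<open>Only \<open>u\<close> and \<open>w\<close> can have three common neighbours, and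
    3^2 = 2 * 3 + 3 fixes the correction.\<close>
  define e where "e = (\<lambda>i j. if i = u \<and> j = w \<or> i = w \<and> j = u then 3 else 0 :: nat)"
  have "(\<Sum>x\<in>V. deg x ^ 2) = deg u ^ 2 + (deg w ^ 2 + (\<Sum>x\<in>V - {u} - {w}. deg x ^ 2))"
    using uw finite_V by (simp add: sum.remove[of V u] sum.remove[of "V - {u}" w])
  also have "(\<Sum>x\<in>V - {u} - {w}. deg x ^ 2) = (\<Sum>x\<in>V - {u} - {w}. 4)"
    using others by (intro sum.cong) auto
  finally have sq: "(\<Sum>x\<in>V. deg x ^ 2) = 4 * card V + 10"
    using uw n finite_V by simp
  have "(\<Sum>i\<in>V. \<Sum>j\<in>V - {i}. e i j) = (\<Sum>i\<in>V. if i = u then 3 else if i = w then 3 else 0)"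
  proof (intro sum.cong refl)
    fix i assume "i \<in> V"
    show "(\<Sum>j\<in>V - {i}. e i j) = (if i = u then 3 else if i = w then 3 else 0)"
      using uw finite_V by (auto simp: e_def)
  qed
  also have "\<dots> = (\<Sum>i\<in>V. (if i = u then 3 else 0) + (if i = w then 3 else 0))"
    using uw by (intro sum.cong) auto
  also have "\<dots> = 6" using uw finite_V by (simp add: sum.distrib)
  finally have e: "(\<Sum>i\<in>V. \<Sum>j\<in>V - {i}. e i j) = 6" .
  have "codeg R i j ^ 2 \<le> 2 * codeg R i j + e i j" if "i \<in> V" "j \<in> V" "i \<noteq> j" for i j
  proof (cases "{i, j} = {u, w}")
    case True
    then have "e i j = 3" "codeg R i j \<le> 3"
      using uw codeg_le[of i j] by (auto simp: e_def doubleton_eq_iff)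
    then have "codeg R i j \<in> {0, 1, 2, 3}" by auto
    then show ?thesis using \<open>e i j = 3\<close> by auto
  next
    case False
    then have "deg i = 2 \<or> deg j = 2"
      using that others[of i] others[of j] by (auto simp: doubleton_eq_iff)
    then have "codeg R i j \<le> 2" using codeg_le[of i j] by auto
    then have "codeg R i j * codeg R i j \<le> 2 * codeg R i j" by (rule mult_right_mono) simp
    then show ?thesis unfolding power2_eq_square by (rule trans_le_add1)
  qed
  from walks4_le[OF this] have w: "walks4 V R \<le> 8 * card V + 32"
    using R sq e by simp
  have "card V + 8 * card V + 7 * card V \<le> card V * card V + card V * card V + 30"
  proof -
    have "5 \<le> card V" using False n by simp
    then obtain k where "card V = 5 + k" using le_Suc_ex by blast
    then show ?thesis by (simp add: algebra_simps)
  qed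
  moreover have "deg x + 1 \<noteq> card V" if "x \<in> V" for x
    using uw others[of x] that n False by (cases "x = u \<or> x = w") auto
  ultimately show ?thesis
    unfolding few_closed_walks_def using w n False by (simp add: power2_eq_square)
qed

text \<open>The excesses deg x - 2 are natural numbers with sum 2, so either one vertex has excess 2
  or two vertices have excess 1.\<close>

lemma few_closed_walks_min_deg_2:
  assumes R: "card R = 2 * card V + 2" and n: "4 \<le> card V" and deg2: "\<And>x. x \<in> V \<Longrightarrow> 2 \<le> deg x"
  shows "few_closed_walks V R"
proof -
  define f where "f x = deg x - 2" for x
  have deg: "deg x = f x + 2" if "x \<in> V" for x using deg2[OF that] by (simp add: f_def)
  have "(\<Sum>x\<in>V. deg x) = (\<Sum>x\<in>V. f x + 2)" using deg by (intro sum.cong) auto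
  also have "\<dots> = (\<Sum>x\<in>V. f x) + (\<Sum>x\<in>V. 2)" by (rule sum.distrib)
  finally have sf: "(\<Sum>x\<in>V. f x) = 2" using sum_deg R by simp
  show ?thesis
  proof (cases "\<exists>u\<in>V. 2 \<le> f u")
    case True
    then obtain u where u: "u \<in> V" "2 \<le> f u" by blast
    have "f u + (\<Sum>x\<in>V - {u}. f x) = 2" using sf u finite_V by (simp add: sum.remove)
    then have "f u = 2" "(\<Sum>x\<in>V - {u}. f x) = 0" using u by auto
    then have "deg u = 4" "\<And>x. x \<in> V \<Longrightarrow> x \<noteq> u \<Longrightarrow> deg x = 2"
      using deg u finite_V by auto
    then show ?thesis using few_closed_walks_deg4 R n u by blast
  next
    case False
    then have f1: "f x = of_bool (x \<in> {x \<in> V. f x = 1})" if "x \<in> V" for x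
      using that by (cases "f x"; cases "f x - 1") force+
    have "(\<Sum>x\<in>V. f x) = (\<Sum>x\<in>V. of_bool (x \<in> {x \<in> V. f x = 1}))"
      by (intro sum.cong refl f1)
    also have "\<dots> = card {x \<in> V. f x = 1}"
      by (subst sum_of_bool_mem[OF finite_V]) (auto intro!: arg_cong[of _ _ card])
    finally have "card {x \<in> V. f x = 1} = 2" using sf by simp
    then obtain u w where uw: "{x \<in> V. f x = 1} = {u, w}" "u \<noteq> w" by (auto simp: card_2_iff)
    then have V: "u \<in> V" "w \<in> V" and "f u = 1" "f w = 1" by blast+
    then have "deg u = 3" "deg w = 3" using deg[of u] deg[of w] by auto
    moreover have "deg x = 2" if "x \<in> V" "x \<noteq> u" "x \<noteq> w" for x
    proof -
      have "f x \<noteq> 1" using that uw by blast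
      moreover have "f x < 2" using that(1) False by auto
      ultimately show ?thesis using deg[OF that(1)] by linarith
    qed
    ultimately show ?thesis using few_closed_walks_deg33[OF R n V uw(2)] by blast
  qed
qed

end

section \<open>Attaching a pendant vertex x to y\<close>

locale pendant = simple_rel +
  fixes x y assumes x: "x \<in> V" and nbr: "R `` {x} = {y}"
begin

abbreviation "V' \<equiv> V - {x}"
abbreviation "R' \<equiv> R - {(x, y), (y, x)}"

lemma y_in: "y \<in> V" "y \<noteq> x" and xy: "(x, y) \<in> R" "(y, x) \<in> R"
proof -
  show *: "(x, y) \<in> R" "(y, x) \<in> R" using nbr R_symD[of x y] by auto
  then show "y \<in> V" "y \<noteq> x" using R_sub not_refl by auto
qed

lemma into_x: "(z, x) \<in> R \<longleftrightarrow> z = y"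
  using nbr R_symD[of z x] xy by auto

sublocale del: simple_rel V' R'
proof
  show "finite V'" using finite_V by simp
  show "R' \<subseteq> V' \<times> V'" using R_sub into_x nbr by auto
  show "sym R'" using sym_R by (auto simp: sym_def)
  show "irrefl R'" using not_refl by (auto simp: irrefl_def)
qed

lemma nbrs_del: "i \<in> V' \<Longrightarrow> R `` {i} = (if i = y then insert x (R' `` {i}) else R' `` {i})"
  using xy into_x by auto

lemma x_notin: "x \<notin> R' `` {i}"
  using into_x by auto

lemma card_R: "card R = card R' + 2"
proof -
  have "card R' = card R - card {(x, y), (y, x)}"
    using xy finite_R by (intro card_Diff_subset) auto
  moreover have "card {(x, y), (y, x)} = 2" using y_in by auto
  moreover have "card {(x, y), (y, x)} \<le> card R" using xy finite_R by (intro card_mono) auto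
  ultimately show ?thesis by simp
qed

lemma card_V: "card V = card V' + 1"
  using x finite_V by (metis Suc_eq_plus1 card_Suc_Diff1)

text \<open>The only neighbour of \<open>x\<close> is \<open>y\<close>, so among the old vertices
  \<open>x\<close> is a new common neighbour only for the pair (y, y).\<close>

lemma codeg_del: "i \<in> V' \<Longrightarrow> j \<in> V' \<Longrightarrow> codeg R i j = codeg R' i j + of_bool (i = y \<and> j = y)"
proof -
  assume i: "i \<in> V'" and j: "j \<in> V'"
  define A B where "A = R' `` {i}" and "B = R' `` {j}"
  have AB: "R `` {i} = (if i = y then insert x A else A)" "R `` {j} = (if j = y then insert x B else B)"
    "x \<notin> A" "x \<notin> B"
    unfolding A_def B_def using i j x_notin by (simp_all only: nbrs_del not_False_eq_True)
  have "finite (A \<inter> B)" unfolding A_def by simp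
  then show "codeg R i j = codeg R' i j + of_bool (i = y \<and> j = y)"
    unfolding codeg_def A_def[symmetric] B_def[symmetric] AB(1,2) using AB(3,4) by simp
qed

lemma codeg_x: "j \<in> V' \<Longrightarrow> codeg R x j = of_bool (j \<in> R' `` {y})" 
  and codeg_x': "j \<in> V' \<Longrightarrow> codeg R j x = of_bool (j \<in> R' `` {y})"
proof -
  assume j: "j \<in> V'"
  have "y \<in> R `` {j} \<longleftrightarrow> j \<in> R' `` {y}"
    using j R_symD[of j y] R_symD[of y j] by auto
  then show 1: "codeg R x j = of_bool (j \<in> R' `` {y})"
    unfolding codeg_def nbr by (auto simp: Int_insert_left)
  then show "codeg R j x = of_bool (j \<in> R' `` {y})"
    by (simp add: codeg_def Int_commute)
qed

text \<open>With d the old degree of \<open>y\<close>, the entry at (y, y) grows from d to d + 1 and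
  adds 2 d + 1, the row and the column of \<open>x\<close> add d each, and the entry at (x, x) adds
  1.\<close>

lemma walks4_pendant: "walks4 V R = walks4 V' R' + 4 * del.deg y + 2"
proof -
  have row: "(\<Sum>j\<in>V. codeg R i j ^ 2) = codeg R i x ^ 2 + (\<Sum>j\<in>V'. codeg R i j ^ 2)" for i
    using x finite_V by (simp add: sum.remove)
  have "(\<Sum>j\<in>V'. (of_bool (j \<in> R' `` {y}) :: nat)) = card (V' \<inter> R' `` {y})"
    using finite_V by (intro sum_of_bool_mem) simp
  also have "V' \<inter> R' `` {y} = R' `` {y}" using del.R_sub by auto
  finally have d: "(\<Sum>j\<in>V'. (of_bool (j \<in> R' `` {y}) :: nat)) = del.deg y" .
  have sqx: "(\<Sum>j\<in>V'. codeg R x j ^ 2) = del.deg y" "(\<Sum>i\<in>V'. codeg R i x ^ 2) = del.deg y"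
    unfolding d[symmetric] by (intro sum.cong refl; simp add: codeg_x codeg_x')+
  have "(\<Sum>i\<in>V'. \<Sum>j\<in>V'. codeg R i j ^ 2)
      = (\<Sum>i\<in>V'. \<Sum>j\<in>V'. codeg R' i j ^ 2 + (if j = y then if i = y then 2 * codeg R' y y + 1 else 0 else 0))"
    by (intro sum.cong refl) (auto simp: codeg_del power2_eq_square)
  also have "\<dots> = walks4 V' R' + (2 * del.deg y + 1)"
    unfolding walks4_def using finite_V y_in by (simp add: sum.distrib)
  finally have inner: "(\<Sum>i\<in>V'. \<Sum>j\<in>V'. codeg R i j ^ 2) = walks4 V' R' + (2 * del.deg y + 1)" .
  have "walks4 V R = (\<Sum>j\<in>V. codeg R x j ^ 2) + (\<Sum>i\<in>V'. \<Sum>j\<in>V. codeg R i j ^ 2)"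
    unfolding walks4_def using x finite_V by (intro sum.remove)
  also have "\<dots> = 1 + del.deg y + (del.deg y + (walks4 V' R' + (2 * del.deg y + 1)))"
    unfolding row sum.distrib sqx inner by (simp add: nbr)
  finally show ?thesis by simp
qed

lemma walks3_pendant: "walks3 V' R' \<le> walks3 V R"
proof -
  have "walks3 V' R' \<le> (\<Sum>i\<in>V'. \<Sum>j\<in>R `` {i}. codeg R i j)"
    unfolding walks3_def
  proof (intro sum_mono)
    fix i
    have "(\<Sum>j\<in>R' `` {i}. codeg R' i j) \<le> (\<Sum>j\<in>R' `` {i}. codeg R i j)"
      unfolding codeg_def by (intro sum_mono card_mono) auto
    also have "\<dots> \<le> (\<Sum>j\<in>R `` {i}. codeg R i j)" by (intro sum_mono2) auto
    finally show "(\<Sum>j\<in>R' `` {i}. codeg R' i j) \<le> (\<Sum>j\<in>R `` {i}. codeg R i j)" .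
  qed
  also have "\<dots> \<le> walks3 V R"
    unfolding walks3_def using finite_V by (intro sum_mono2) auto
  finally show ?thesis .
qed

lemma cut_connected_pendant:
  assumes "cut_connected V R"
  shows "cut_connected V' R'"
  unfolding cut_connected_def
proof (intro allI impI)
  fix S assume S: "S \<noteq> {}" "S \<subset> V'"
  \<comment> \<open>Putting \<open>x\<close> on the side of \<open>y\<close> ensures that the arc
    crossing the cut is not one of the deleted ones.\<close>
  define S' where "S' = (if y \<in> S then insert x S else S)"
  have "S' \<noteq> {}" "S' \<subset> V" using S x unfolding S'_def by auto
  then obtain a b where ab: "a \<in> S'" "b \<in> V - S'" "(a, b) \<in> R"
    using assms unfolding cut_connected_def by blast
  have "a \<noteq> x" using ab nbr y_in S unfolding S'_def by (auto split: if_splits)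
  moreover have "b \<noteq> x" using ab into_x unfolding S'_def by (auto split: if_splits)
  ultimately show "\<exists>a\<in>S. \<exists>b\<in>V' - S. (a, b) \<in> R'"
    using ab unfolding S'_def by (intro bexI[of _ a] bexI[of _ b]) (auto split: if_splits)
qed

text \<open>Let d be the old degree of \<open>y\<close> and n' the old number of vertices. The count
  grows by 4 d + 2. The first two alternatives allow growth 4 n' - 2, which is d \<le> n' - 1; the
  third allows 4 n' - 6, which is d \<le> n' - 2 and holds because \<open>y\<close> was not
  dominating. For the same reason no dominating vertex arises.\<close>

lemma few_closed_walks_pendant:
  assumes few: "few_closed_walks V' R'"
  shows "few_closed_walks V R"
proof -
  have dy: "del.deg y + 1 \<le> card V'" using del.deg_less[of y] y_in by simp
  consider "walks4 V' R' + 4 * card V' \<le> 2 * card V' ^ 2 + 34" "12 \<le> walks3 V' R'"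
    | "walks4 V' R' + 4 * card V' \<le> 2 * card V' ^ 2 + 30"
    | "5 \<le> card V'" "walks4 V' R' + 8 * card V' \<le> 2 * card V' ^ 2 + 62" "\<forall>x\<in>V'. del.deg x + 1 \<noteq> card V'"
    using few unfolding few_closed_walks_def by blast
  then show ?thesis
  proof cases
    case 1
    then show ?thesis using dy walks4_pendant walks3_pendant card_V
      unfolding few_closed_walks_def by (simp add: power2_eq_square)
  next
    case 2
    then show ?thesis using dy walks4_pendant card_V
      unfolding few_closed_walks_def by (simp add: power2_eq_square)
  next
    case 3
    have dy': "del.deg y + 2 \<le> card V'" using 3(3) dy y_in by (metis Diff_iff Suc_eq_plus1 Suc_leI add_2_eq_Suc' le_neq_implies_less singletonD)
    have "deg z + 1 \<noteq> card V" if "z \<in> V" for z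
    proof (cases "z = x")
      case True
      then show ?thesis using dy' card_V nbr by simp
    next
      case False
      then have "deg z \<le> del.deg z + of_bool (z = y)" using nbrs_del[of z] that by (auto simp: card_insert_if)
      then show ?thesis using dy' card_V del.deg_less[of z] 3(3) False that
        by (cases "z = y") auto
    qed
    then show ?thesis using 3 dy' walks4_pendant card_V
      unfolding few_closed_walks_def by (simp add: power2_eq_square)
  qed
qed

end

text \<open>Pendant vertices are stripped until the minimum degree is 2. Connectivity excludes
  degree 0, so a vertex of degree below 2 is pendant.\<close>

lemma few_closed_walks_bicyclic:
  assumes "simple_rel V R" "cut_connected V R" "card R = 2 * card V + 2"
  shows "few_closed_walks V R"
  using assms
proof (induction "card V" arbitrary: V R)
  case 0
  then interpret simple_rel V R by simp
  show ?case using 0 R_sub finite_V by auto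
next
  case (Suc k)
  then interpret simple_rel V R by simp
  show ?case
  proof (cases "\<forall>x\<in>V. 2 \<le> deg x")
    case True
    \<comment> \<open>Every degree is at most n - 1, and 2 n + 2 \<le> n (n - 1) fails for n \<le>
      3.\<close>
    have "2 * card V + 2 \<le> card V * (card V - 1)"
      using sum_bounded_above[of V deg "card V - 1"] deg_less Suc.prems(3) sum_deg by fastforce
    then have "4 \<le> card V"
      by (cases "card V \<in> {0, 1, 2, 3}") auto
    then show ?thesis using few_closed_walks_min_deg_2 Suc.prems True by blast
  next
    case False
    then obtain x where x: "x \<in> V" "deg x < 2" by auto
    have "{x} \<noteq> V"
    proof
      assume V: "{x} = V"
      then have "R = {}" using R_sub not_refl by auto
      then show False using Suc.prems(3) by simp
    qed
    then have "{x} \<subset> V" using x by auto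
    then obtain y where "(x, y) \<in> R"
      using Suc.prems(2) unfolding cut_connected_def by blast
    then have "0 < deg x" by (auto simp: card_gt_0_iff)
    then have "deg x = 1" using x by simp
    then obtain y where y: "R `` {x} = {y}" by (auto simp: card_1_singleton_iff)
    interpret pendant V R x y using x y by unfold_locales auto
    have "few_closed_walks V' R'"
      using Suc card_V card_R cut_connected_pendant del.simple_rel_axioms by simp
    then show ?thesis by (rule few_closed_walks_pendant)
  qed
qed

section \<open>The energy of a graph\<close>

text \<open>The traces are written in terms of \<open>A * A\<close>, whose entries are codegrees for
  a graph and short sums for a quotient matrix.\<close>

lemma mat_trace_powers:
  fixes A :: "'a :: comm_ring_1 mat"
  assumes A: "A \<in> carrier_mat n n"
  shows "mat_trace (A ^\<^sub>m 1) = (\<Sum>i<n. A $$ (i, i))"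
    and "mat_trace (A ^\<^sub>m 2) = (\<Sum>i<n. (A * A) $$ (i, i))"
    and "mat_trace (A ^\<^sub>m 3) = (\<Sum>i<n. \<Sum>j<n. (A * A) $$ (i, j) * A $$ (j, i))"
    and "mat_trace (A ^\<^sub>m 4) = (\<Sum>i<n. \<Sum>j<n. (A * A) $$ (i, j) * (A * A) $$ (j, i))"
proof -
  have tr: "mat_trace (B * C) = (\<Sum>i<n. \<Sum>j<n. B $$ (i, j) * C $$ (j, i))"
    if "B \<in> carrier_mat n n" "C \<in> carrier_mat n n" for B C :: "'a mat"
    using that by (auto simp: mat_trace_def scalar_prod_def atLeast0LessThan intro!: sum.cong)
  have p: "A ^\<^sub>m 1 = A" "A ^\<^sub>m 2 = A * A" "A ^\<^sub>m 3 = (A * A) * A" "A ^\<^sub>m 4 = (A * A) * A * A"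
    using A by (simp_all add: eval_nat_numeral)
  show "mat_trace (A ^\<^sub>m 1) = (\<Sum>i<n. A $$ (i, i))"
    "mat_trace (A ^\<^sub>m 2) = (\<Sum>i<n. (A * A) $$ (i, i))"
    unfolding p using A by (simp_all add: mat_trace_def)
  show "mat_trace (A ^\<^sub>m 3) = (\<Sum>i<n. \<Sum>j<n. (A * A) $$ (i, j) * A $$ (j, i))"
    unfolding p using A by (intro tr) auto
  have "(A * A) * A * A = (A * A) * (A * A)"
    using A by (intro assoc_mult_mat) auto
  then show "mat_trace (A ^\<^sub>m 4) = (\<Sum>i<n. \<Sum>j<n. (A * A) $$ (i, j) * (A * A) $$ (j, i))"
    unfolding p using A by (simp add: tr)
qed

lemma pair_graph_simple_rel:
  assumes "pair_graph G"
  shows "simple_rel (pverts G) (parcs G)"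
proof -
  interpret pair_graph G by fact
  show ?thesis
  proof
    show "finite (pverts G)" by (rule pair_finite_verts)
    show "parcs G \<subseteq> pverts G \<times> pverts G" using in_arcsD1 in_arcsD2 by auto
    show "sym (parcs G)" using pair_sym_arcs by (simp add: symmetric_def)
    show "irrefl (parcs G)"
    proof (rule irreflI)
      fix a show "(a, a) \<notin> parcs G" using pair_no_loops[of "(a, a)"] by auto
    qed
  qed
qed

lemma sum_nth:
  assumes "distinct vs"
  shows "(\<Sum>i<length vs. f (vs ! i)) = (\<Sum>x\<in>set vs. f x)"
  using sum.reindex_bij_betw[OF bij_betw_nth[OF assms refl refl], of f] .

context
  fixes G :: "'a pair_pre_digraph" and vs :: "'a list"
  assumes G: "pair_graph G" and vs: "distinct vs" "set vs = pverts G"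
begin

interpretation simple_rel "pverts G" "parcs G"
  using G by (rule pair_graph_simple_rel)

abbreviation "adjmat \<equiv> adjacency_matrix G vs"

lemma adjacency_carrier: "adjmat \<in> carrier_mat (length vs) (length vs)"
  by (simp add: adjacency_matrix_def)

lemma adjacency_square:
  assumes "i < length vs" "j < length vs"
  shows "(adjmat * adjmat) $$ (i, j) = of_nat (codeg (parcs G) (vs ! i) (vs ! j))"
proof -
  let ?N = "parcs G `` {vs ! i} \<inter> parcs G `` {vs ! j}"
  have "(adjmat * adjmat) $$ (i, j) = (\<Sum>k<length vs. adjmat $$ (i, k) * adjmat $$ (k, j))"
    using assms by (simp add: adjacency_matrix_def scalar_prod_def atLeast0LessThan)
  also have "\<dots> = (\<Sum>k<length vs. of_bool (vs ! k \<in> ?N))"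
  proof (intro sum.cong refl)
    fix k assume "k \<in> {..<length vs}"
    then show "adjmat $$ (i, k) * adjmat $$ (k, j) = of_bool (vs ! k \<in> ?N)"
      using assms R_symD[of "vs ! k" "vs ! j"] R_symD[of "vs ! j" "vs ! k"]
      by (auto simp: adjacency_matrix_def)
  qed
  also have "\<dots> = (\<Sum>x\<in>pverts G. of_bool (x \<in> ?N))"
    using sum_nth[OF vs(1), of "\<lambda>x. of_bool (x \<in> ?N) :: complex"] vs(2) by simp
  also have "\<dots> = of_nat (\<Sum>x\<in>pverts G. of_bool (x \<in> ?N))"
    by simp
  also have "(\<Sum>x\<in>pverts G. of_bool (x \<in> ?N)) = card (pverts G \<inter> ?N)"
    using finite_V by (rule sum_of_bool_mem)
  also have "pverts G \<inter> ?N = ?N" using nbrs_sub by auto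
  finally show ?thesis unfolding codeg_def .
qed

lemma adjacency_traces:
  shows "mat_trace (adjmat ^\<^sub>m 1) = 0"
    and "mat_trace (adjmat ^\<^sub>m 2) = of_nat (card (parcs G))"
    and "mat_trace (adjmat ^\<^sub>m 3) = of_nat (walks3 (pverts G) (parcs G))"
    and "mat_trace (adjmat ^\<^sub>m 4) = of_nat (walks4 (pverts G) (parcs G))"
proof -
  note tr = mat_trace_powers[OF adjacency_carrier]
  show "mat_trace (adjmat ^\<^sub>m 1) = 0"
    unfolding tr using not_refl by (intro sum.neutral) (auto simp: adjacency_matrix_def)
  have "mat_trace (adjmat ^\<^sub>m 2) = (\<Sum>i<length vs. of_nat (deg (vs ! i)))"
    unfolding tr by (intro sum.cong) (auto simp: adjacency_square)
  also have "\<dots> = of_nat (\<Sum>x\<in>pverts G. deg x)"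
    using sum_nth[OF vs(1), of "\<lambda>x. of_nat (deg x) :: complex"] vs(2) by simp
  finally show "mat_trace (adjmat ^\<^sub>m 2) = of_nat (card (parcs G))" by (simp only: sum_deg)
  have "(\<Sum>j<length vs. (adjmat * adjmat) $$ (i, j) * adjmat $$ (j, i)) = of_nat (\<Sum>y\<in>parcs G `` {vs ! i}. codeg (parcs G) (vs ! i) y)"
    if i: "i < length vs" for i
  proof -
    let ?f = "\<lambda>y. of_nat (codeg (parcs G) (vs ! i) y) * of_bool (y \<in> parcs G `` {vs ! i}) :: complex"
    have "(\<Sum>j<length vs. (adjmat * adjmat) $$ (i, j) * adjmat $$ (j, i)) = (\<Sum>j<length vs. ?f (vs ! j))"
    proof (intro sum.cong refl)
      fix j assume j: "j \<in> {..<length vs}"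
      have "adjmat $$ (j, i) = of_bool (vs ! j \<in> parcs G `` {vs ! i})"
        using i j R_symD[of "vs ! i" "vs ! j"] R_symD[of "vs ! j" "vs ! i"] by (auto simp: adjacency_matrix_def)
      then show "(adjmat * adjmat) $$ (i, j) * adjmat $$ (j, i) = ?f (vs ! j)"
        using adjacency_square[OF i, of j] j by simp
    qed
    also have "\<dots> = (\<Sum>y\<in>pverts G. ?f y)"
      using sum_nth[OF vs(1), of ?f] vs(2) by simp
    also have "\<dots> = (\<Sum>y\<in>parcs G `` {vs ! i}. of_nat (codeg (parcs G) (vs ! i) y))"
      using nbrs_sub finite_V by (intro sum.mono_neutral_cong_right) auto
    finally show ?thesis by simp
  qed
  then have "mat_trace (adjmat ^\<^sub>m 3) = (\<Sum>i<length vs. of_nat (\<Sum>y\<in>parcs G `` {vs ! i}. codeg (parcs G) (vs ! i) y))"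
    unfolding tr by (intro sum.cong) auto
  also have "\<dots> = of_nat (walks3 (pverts G) (parcs G))"
    unfolding walks3_def of_nat_sum[of _ "pverts G"]
    using sum_nth[OF vs(1), of "\<lambda>x. of_nat (\<Sum>y\<in>parcs G `` {x}. codeg (parcs G) x y) :: complex"] vs(2)
    by simp
  finally show "mat_trace (adjmat ^\<^sub>m 3) = of_nat (walks3 (pverts G) (parcs G))" .
  let ?c = "\<lambda>x y. of_nat (codeg (parcs G) x y ^ 2) :: complex"
  have "mat_trace (adjmat ^\<^sub>m 4) = (\<Sum>i<length vs. \<Sum>j<length vs. ?c (vs ! i) (vs ! j))"
    unfolding tr
    by (intro sum.cong refl) (simp add: adjacency_square power2_eq_square codeg_def Int_commute)
  also have "\<dots> = (\<Sum>i<length vs. \<Sum>y\<in>pverts G. ?c (vs ! i) y)"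
    using sum_nth[OF vs(1), of "?c x" for x] vs(2) by simp
  also have "\<dots> = (\<Sum>x\<in>pverts G. \<Sum>y\<in>pverts G. ?c x y)"
    using sum_nth[OF vs(1), of "\<lambda>x. \<Sum>y\<in>pverts G. ?c x y"] vs(2) by simp
  finally show "mat_trace (adjmat ^\<^sub>m 4) = of_nat (walks4 (pverts G) (parcs G))"
    by (simp add: walks4_def)
qed

text \<open>
  The nonzero eigenvalues of \<open>U V\<close> and \<open>V U\<close> agree, so a factorization through a small
  dimension \<open>k\<close> gives the energy. With \<open>U = 1\<close> it also covers the general case below.
\<close>

lemma energy_factorization:
  assumes U: "U \<in> carrier_mat (length vs) k" and V: "V \<in> carrier_mat k (length vs)" and fact: "adjmat = U * V"
  obtains X where "size X = k" "energy G = (\<Sum>x\<in>#X. \<bar>x\<bar>)"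
    "\<And>j. complex_of_real (psum j X) = mat_trace ((V * U) ^\<^sub>m j)"
proof -
  let ?n = "length vs"
  have M: "V * U \<in> carrier_mat k k" using U V by auto
  let ?p = "char_poly adjmat" and ?q = "char_poly (V * U)"
  have nz: "?p \<noteq> 0" "?q \<noteq> 0"
    using degree_monic_char_poly[OF adjacency_carrier] degree_monic_char_poly[OF M] by auto
  have "[:0, 1:] ^ k * ?p = [:0, 1:] ^ ?n * ?q"
    unfolding fact by (rule char_poly_mult_comm[OF U V])
  then have "proots ([:0, 1:] ^ k * ?p) = proots ([:0, 1:] ^ ?n * ?q)" by simp
  then have roots: "repeat_mset k {#0#} + proots ?p = repeat_mset ?n {#0#} + proots ?q"
    using nz by (simp add: proots_mult proots_power)
  have rep: "(\<Sum>\<mu>\<in>#repeat_mset j {#0#}. cmod \<mu>) = 0" for j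
    by (simp add: sum_mset.neutral)
  have "(\<Sum>\<mu>\<in>#repeat_mset k {#0#} + proots ?p. cmod \<mu>) = (\<Sum>\<mu>\<in>#repeat_mset ?n {#0#} + proots ?q. cmod \<mu>)"
    unfolding roots ..
  then have "energy G = (\<Sum>\<mu>\<in>#proots ?q. cmod \<mu>)"
    unfolding energy_eq[OF vs] by (simp only: image_mset_union sum_mset.union rep add_0)
  \<comment> \<open>The matrix \<open>V * U\<close> need not be symmetric; its nonzero eigenvalues
    are real because they are eigenvalues of the adjacency matrix.\<close>
  have real: "\<mu> \<in> \<real>" if "\<mu> \<in># proots ?q" for \<mu>
  proof -
    have "\<mu> \<in># repeat_mset k {#0#} + proots ?p" using that unfolding roots by simp
    then consider "\<mu> = 0" | "\<mu> \<in># proots ?p" by (auto split: if_splits)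
    then show ?thesis
    proof cases
      case 2
      have "cnj (adjmat $$ (i, j)) = adjmat $$ (j, i)" if "i < ?n" "j < ?n" for i j
        using that R_symD[of "vs ! i" "vs ! j"] R_symD[of "vs ! j" "vs ! i"] by (auto simp: adjacency_matrix_def)
      then show ?thesis using hermitian_proots_real[OF adjacency_carrier _ 2] by blast
    qed simp
  qed
  define X where "X = image_mset Re (proots ?q)"
  have X: "image_mset complex_of_real X = proots ?q"
    unfolding X_def multiset.map_comp using real
    by (intro multiset.map_ident_strong) (simp add: of_real_Re)
  show thesis
  proof
    show "size X = k"
      unfolding X_def using degree_monic_char_poly[OF M] by (simp add: size_proots_complex)
    show "energy G = (\<Sum>x\<in>#X. \<bar>x\<bar>)"
      unfolding \<open>energy G = _\<close> X[symmetric] by (simp add: multiset.map_comp comp_def)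
    show "complex_of_real (psum j X) = mat_trace ((V * U) ^\<^sub>m j)" for j
      unfolding mat_trace_pow_eq_sum_proots[OF M] X[symmetric] psum_def
      by (induction X) simp_all
  qed
qed

lemma energy_power_sums:
  obtains X where "energy G = (\<Sum>x\<in>#X. \<bar>x\<bar>)" "psum 1 X = 0" "psum 2 X = card (parcs G)"
    "psum 3 X = walks3 (pverts G) (parcs G)" "psum 4 X = walks4 (pverts G) (parcs G)"
proof -
  have "adjmat = 1\<^sub>m (length vs) * adjmat" using adjacency_carrier by simp
  then obtain X where X: "energy G = (\<Sum>x\<in>#X. \<bar>x\<bar>)"
    "\<And>j. complex_of_real (psum j X) = mat_trace ((adjmat * 1\<^sub>m (length vs)) ^\<^sub>m j)"
    using energy_factorization[OF one_carrier_mat adjacency_carrier] by blast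
  have "complex_of_real (psum j X) = mat_trace (adjmat ^\<^sub>m j)" for j
    using X(2)[of j] adjacency_carrier by simp
  then have "psum j X = real N" if "mat_trace (adjmat ^\<^sub>m j) = of_nat N" for j N
    using that by (metis of_real_eq_iff of_real_of_nat_eq)
  from this[of 1 0] this[OF adjacency_traces(2)] this[OF adjacency_traces(3)] this[OF adjacency_traces(4)]
  show thesis using that[of X] X(1) adjacency_traces(1) by simp
qed

end

section \<open>The extremal graphs\<close>

text \<open>A zero sum and a nonnegative product force two nonpositive and two nonnegative numbers.
  Each half then has no third elementary symmetric sum, and (P + Q)^2 = 4 P Q + (Q - P)^2 turns the
  lower bounds into equalities, with P Q = c and s (Q - P) = e.\<close>

lemma abs_sum_of_four_reals:
  fixes X :: "real multiset" and m c e :: real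
  defines "s \<equiv> (\<Sum>x\<in>#X. \<bar>x\<bar>) / 2"
  assumes size: "size X = 4" and p: "psum 1 X = 0" "psum 2 X = 2 * m" "psum 3 X = 3 * e" "psum 4 X = 2 * m ^ 2 - 4 * c"
    and c: "0 \<le> c" and m: "0 < m"
  shows "0 < s" "m \<le> s ^ 2" "(s ^ 2 - m) ^ 2 = 4 * c + e ^ 2 / s ^ 2"
proof -
  define xs where "xs = sorted_list_of_multiset X"
  have X: "mset xs = X" and srt: "sorted xs" by (simp_all add: xs_def)
  then have "length xs = 4" using size by (metis size_mset)
  then obtain a b x d where xs: "xs = [a, b, x, d]"
    by (auto simp: length_Suc_conv eval_nat_numeral)
  have Xe: "X = {#a, b, x, d#}" using X xs by simp
  have le: "a \<le> b" "b \<le> x" "x \<le> d" using srt xs by auto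
  have q: "a + b + x + d = 0" "a ^ 2 + b ^ 2 + x ^ 2 + d ^ 2 = 2 * m"
     "a ^ 3 + b ^ 3 + x ^ 3 + d ^ 3 = 3 * e" "a ^ 4 + b ^ 4 + x ^ 4 + d ^ 4 = 2 * m ^ 2 - 4 * c"
    using p unfolding Xe by (simp_all add: add.assoc)
  have d: "d = - (a + b + x)" using q(1) by simp
  \<comment> \<open>Newton's identity p_2^2 - 2 p_4 = 8 e_4 for four numbers with sum zero
    identifies \<open>c\<close> as their product.\<close>
  have "(a ^ 2 + b ^ 2 + x ^ 2 + d ^ 2) ^ 2 - 2 * (a ^ 4 + b ^ 4 + x ^ 4 + d ^ 4) = 8 * (a * b * (x * d))"
    unfolding d by (simp add: algebra_simps power2_eq_square power4_eq_xxxx)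
  then have prod: "a * b * (x * d) = c" unfolding q by (simp add: power2_eq_square)
  have b0: "b \<le> 0"
  proof (rule ccontr)
    assume "\<not> b \<le> 0"
    then have "0 < b" "0 < x" "0 < d" "a < 0" using le d by auto
    then have "a * b * (x * d) < 0" by (intro mult_neg_pos mult_pos_pos)
    then show False using prod c by simp
  qed
  have x0: "0 \<le> x"
  proof (rule ccontr)
    assume "\<not> 0 \<le> x"
    then have "b < 0" "x < 0" "0 < d" "a < 0" using le d by auto
    then have "a * b * (x * d) < 0" by (intro mult_pos_neg mult_neg_neg mult_neg_pos)
    then show False using prod c by simp
  qed
  have s: "s = x + d" "s = - (a + b)"
    unfolding s_def Xe using b0 x0 le d by auto
  define P Q where "P = x * d" and "Q = a * b"
  have PQ0: "0 \<le> P" "0 \<le> Q" and PQ: "Q * P = c"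
    using le b0 x0 prod by (auto simp: P_def Q_def mult_nonpos_nonpos)
  have ab: "a + b = - s" and xd: "x + d = s" using s by simp_all
  have "a ^ 2 + b ^ 2 = (a + b) ^ 2 - 2 * Q" "x ^ 2 + d ^ 2 = (x + d) ^ 2 - 2 * P"
    unfolding P_def Q_def by (simp_all add: algebra_simps power2_eq_square power3_eq_cube)
  then have "a ^ 2 + b ^ 2 = s ^ 2 - 2 * Q" "x ^ 2 + d ^ 2 = s ^ 2 - 2 * P"
    unfolding ab xd by simp_all
  then have sm: "s ^ 2 - m = P + Q" using q(2) by linarith
  then show ms: "m \<le> s ^ 2" using PQ0 by simp
  have "s \<noteq> 0" using ms m by auto
  then show sp: "0 < s" using s(1) x0 le by auto
  have "a ^ 3 + b ^ 3 = (a + b) ^ 3 - 3 * Q * (a + b)" "x ^ 3 + d ^ 3 = (x + d) ^ 3 - 3 * P * (x + d)"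
    unfolding P_def Q_def by (simp_all add: algebra_simps power2_eq_square power3_eq_cube)
  then have "a ^ 3 + b ^ 3 = 3 * (s * Q) - s ^ 3" "x ^ 3 + d ^ 3 = s ^ 3 - 3 * (s * P)"
    unfolding ab xd by simp_all
  then have "e = s * Q - s * P" using q(3) by linarith
  then have "e = s * (Q - P)" by (simp add: right_diff_distrib)
  then have "e ^ 2 / s ^ 2 = (Q - P) ^ 2" using sp by (simp add: power_mult_distrib)
  then show "(s ^ 2 - m) ^ 2 = 4 * c + e ^ 2 / s ^ 2"
    unfolding sm PQ[symmetric] by (simp add: power2_eq_square algebra_simps)
qed

lemma sum_lessThan_4: "(\<Sum>i<4. f i) = f 0 + f (Suc 0) + f 2 + f (3 :: nat)"
  by (simp add: eval_nat_numeral)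

text \<open>
  Vertices of the same class \<open>cl\<close> have the same neighbours \<open>{j. r (cl i) j}\<close>, so the adjacency matrix
  factors through the four classes and \<open>Q\<close> is the resulting quotient matrix.
\<close>

lemma energy_four_classes:
  fixes G :: "nat pair_pre_digraph" and Q :: "nat \<Rightarrow> nat \<Rightarrow> nat"
  assumes G: "pair_graph G" "pverts G = {0..<n}"
    and cl: "\<And>i. i < n \<Longrightarrow> cl i < (4 :: nat)"
    and r: "\<And>i j. i < n \<Longrightarrow> j < n \<Longrightarrow> (i, j) \<in> parcs G \<longleftrightarrow> r (cl i) j"
    and Q: "\<And>k l. k < 4 \<Longrightarrow> l < 4 \<Longrightarrow> card {j. j < n \<and> r k j \<and> cl j = l} = Q k l"
    and e: "(\<Sum>i<4. Q i i) = 0"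
      "(\<Sum>i<4. \<Sum>k<4. Q i k * Q k i) = 2 * m"
      "(\<Sum>i<4. \<Sum>j<4. (\<Sum>k<4. Q i k * Q k j) * Q j i) = 3 * e"
      "(\<Sum>i<4. \<Sum>j<4. (\<Sum>k<4. Q i k * Q k j) * (\<Sum>k<4. Q j k * Q k i)) + 4 * c = 2 * m ^ 2"
    and m: "0 < m"
  defines "s \<equiv> energy G / 2"
  shows "0 < s \<and> real m \<le> s ^ 2 \<and> (s ^ 2 - real m) ^ 2 = 4 * real c + real e ^ 2 / s ^ 2"
proof -
  define U :: "complex mat" where "U = mat n 4 (\<lambda>(i, k). of_bool (cl i = k))"
  define V :: "complex mat" where "V = mat 4 n (\<lambda>(k, j). of_bool (r k j))"
  let ?A = "adjacency_matrix G [0..<n]"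
  have UV: "U \<in> carrier_mat n 4" "V \<in> carrier_mat 4 n" by (simp_all add: U_def V_def)
  have A: "?A = U * V"
  proof (rule eq_matI)
    fix i j assume "i < dim_row (U * V)" "j < dim_col (U * V)"
    then have ij: "i < n" "j < n" using UV by auto
    have "(U * V) $$ (i, j) = (\<Sum>k<4. of_bool (cl i = k) * of_bool (r k j))"
      using ij by (simp add: U_def V_def scalar_prod_def atLeast0LessThan)
    also have "\<dots> = (\<Sum>k<4. if k = cl i then of_bool (r (cl i) j) else 0)"
      by (intro sum.cong) auto
    also have "\<dots> = ?A $$ (i, j)"
      using ij cl[of i] r[of i j] by (simp add: adjacency_matrix_def)
    finally show "?A $$ (i, j) = (U * V) $$ (i, j)" ..
  qed (use UV in \<open>auto simp: adjacency_matrix_def\<close>)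
  have M: "V * U \<in> carrier_mat 4 4" using UV by simp
  have entry: "(V * U) $$ (k, l) = of_nat (Q k l)" if "k < 4" "l < 4" for k l
  proof -
    have "(V * U) $$ (k, l) = (\<Sum>j<n. of_bool (r k j) * of_bool (cl j = l))"
      using that by (simp add: U_def V_def scalar_prod_def atLeast0LessThan)
    also have "\<dots> = (\<Sum>j<n. of_bool (j \<in> {j. r k j \<and> cl j = l}))"
      by (intro sum.cong) auto
    also have "\<dots> = of_nat (\<Sum>j<n. of_bool (j \<in> {j. r k j \<and> cl j = l}))"
      by (simp only: of_nat_sum of_nat_of_bool)
    also have "(\<Sum>j<n. of_bool (j \<in> {j. r k j \<and> cl j = l})) = card ({..<n} \<inter> {j. r k j \<and> cl j = l})"
      by (rule sum_of_bool_mem) simp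
    also have "{..<n} \<inter> {j. r k j \<and> cl j = l} = {j. j < n \<and> r k j \<and> cl j = l}" by auto
    finally show ?thesis using Q that by simp
  qed
  have sq: "((V * U) * (V * U)) $$ (k, l) = of_nat (\<Sum>j<4. Q k j * Q j l)" if "k < 4" "l < 4" for k l
  proof -
    have "(B * B) $$ (k, l) = (\<Sum>j<4. B $$ (k, j) * B $$ (j, l))" if "B \<in> carrier_mat 4 4" for B :: "complex mat"
      using \<open>k < 4\<close> \<open>l < 4\<close> that by (simp add: scalar_prod_def atLeast0LessThan)
    from this[OF M]
    have "((V * U) * (V * U)) $$ (k, l) = (\<Sum>j<4. (V * U) $$ (k, j) * (V * U) $$ (j, l))" .
    also have "\<dots> = (\<Sum>j<4. of_nat (Q k j * Q j l))"
      using that by (intro sum.cong) (simp_all add: entry)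
    finally show ?thesis by simp
  qed
  note tr = mat_trace_powers[OF M]
  have "mat_trace ((V * U) ^\<^sub>m 1) = of_nat (\<Sum>i<4. Q i i)"
    unfolding tr of_nat_sum by (intro sum.cong refl) (simp add: entry)
  moreover have "mat_trace ((V * U) ^\<^sub>m 2) = of_nat (\<Sum>i<4. \<Sum>k<4. Q i k * Q k i)"
    unfolding tr of_nat_sum[of _ "{..<4}"] by (intro sum.cong refl) (simp only: lessThan_iff sq of_nat_sum)
  moreover have "mat_trace ((V * U) ^\<^sub>m 3) = of_nat (\<Sum>i<4. \<Sum>j<4. (\<Sum>k<4. Q i k * Q k j) * Q j i)"
    unfolding tr of_nat_sum[of "\<lambda>i. \<Sum>j<4. (\<Sum>k<4. Q i k * Q k j) * Q j i"]
      of_nat_sum[of "\<lambda>j. (\<Sum>k<4. Q i k * Q k j) * Q j i" for i]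
    by (intro sum.cong refl) (simp only: lessThan_iff sq entry of_nat_mult)
  moreover have "mat_trace ((V * U) ^\<^sub>m 4)
      = of_nat (\<Sum>i<4. \<Sum>j<4. (\<Sum>k<4. Q i k * Q k j) * (\<Sum>k<4. Q j k * Q k i))"
    unfolding tr of_nat_sum[of "\<lambda>i. \<Sum>j<4. (\<Sum>k<4. Q i k * Q k j) * (\<Sum>k<4. Q j k * Q k i)"]
      of_nat_sum[of "\<lambda>j. (\<Sum>k<4. Q i k * Q k j) * (\<Sum>k<4. Q j k * Q k i)" for i]
    by (intro sum.cong refl) (simp only: lessThan_iff sq of_nat_mult)
  moreover obtain X where X: "size X = 4" "energy G = (\<Sum>x\<in>#X. \<bar>x\<bar>)"
    "\<And>j. complex_of_real (psum j X) = mat_trace ((V * U) ^\<^sub>m j)"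
    using energy_factorization[of G "[0..<n]" U 4 V] G UV A by auto
  moreover have "psum j X = real N" if "mat_trace ((V * U) ^\<^sub>m j) = of_nat N" for j N
    using that X(3) by (metis of_real_eq_iff of_real_of_nat_eq)
  ultimately have "psum 1 X = real (\<Sum>i<4. Q i i)"
    "psum 2 X = real (\<Sum>i<4. \<Sum>k<4. Q i k * Q k i)"
    "psum 3 X = real (\<Sum>i<4. \<Sum>j<4. (\<Sum>k<4. Q i k * Q k j) * Q j i)"
    "psum 4 X = real (\<Sum>i<4. \<Sum>j<4. (\<Sum>k<4. Q i k * Q k j) * (\<Sum>k<4. Q j k * Q k i))"
    by blast+
  moreover have "real (\<Sum>i<4. \<Sum>j<4. (\<Sum>k<4. Q i k * Q k j) * (\<Sum>k<4. Q j k * Q k i)) + 4 * real c = 2 * real m ^ 2"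
    using arg_cong[OF e(4), of real] by (simp only: of_nat_add of_nat_mult of_nat_power of_nat_numeral)
  ultimately have p: "psum 1 X = 0" "psum 2 X = 2 * real m" "psum 3 X = 3 * real e" 
      "psum 4 X = 2 * real m ^ 2 - 4 * real c"
    unfolding e(1-3) by simp_all
  show ?thesis
    unfolding s_def X(2) using abs_sum_of_four_reals[OF X(1) p] m by auto
qed

section \<open>Edge lists, connectivity and counting of edges\<close>

lemma pair_graph_increasing:
  fixes E :: "(nat \<times> nat) set"
  assumes "\<And>i j. (i, j) \<in> E \<Longrightarrow> i < j \<and> j < n"
  defines "G \<equiv> \<lparr>pverts = {0..<n}, parcs = E \<union> E\<inverse>\<rparr>"
  shows "pair_graph G" "card (edge_set G) = card E"
proof -
  have "E \<subseteq> {0..<n} \<times> {0..<n}" using assms(1) by fastforce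
  then have "finite E" by (rule finite_subset) simp
  then show "pair_graph G"
    unfolding G_def using assms(1)
    by unfold_locales (fastforce simp: symmetric_def sym_def)+
  have "edge_set G = (\<lambda>(x, y). {x, y}) ` E"
    unfolding edge_set_def G_def by (force simp: insert_commute)
  moreover have "inj_on (\<lambda>(x, y). {x, y}) E"
  proof (rule inj_onI)
    fix p q assume "p \<in> E" "q \<in> E" and "(\<lambda>(x, y). {x, y}) p = (\<lambda>(x, y). {x, y}) q"
    then show "p = q"
      using assms(1)[of "fst p" "snd p"] assms(1)[of "fst q" "snd q"]
      by (cases p; cases q) (auto simp: doubleton_eq_iff)
  qed
  ultimately show "card (edge_set G) = card E" by (simp add: card_image)
qed

lemma connected_if_reachable_from:
  assumes "pair_graph G" "a \<in> pverts G" "\<And>v. v \<in> pverts G \<Longrightarrow> (a, v) \<in> (parcs G)\<^sup>*"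
  shows "Digraph_Component.connected (with_proj G)"
proof -
  interpret simple_rel "pverts G" "parcs G"
    using assms(1) by (rule pair_graph_simple_rel)
  have symcl: "symcl (parcs G) = parcs G" using R_symD by (auto simp: symcl_def)
  have "(u, v) \<in> rtrancl_on (pverts G) (parcs G)" if "u \<in> pverts G" "v \<in> pverts G" for u v
  proof (rule rtrancl_consistent_rtrancl_on)
    have "(u, a) \<in> (parcs G)\<^sup>*" using assms(3)[OF that(1)] sym_rtrancl[OF sym_R] by (auto dest: symD)
    then show "(u, v) \<in> (parcs G)\<^sup>*" using assms(3)[OF that(2)] by (rule rtrancl_trans)
  qed (use that R_sub in auto)
  then show ?thesis
    unfolding connected_conv using assms(2) by (auto simp: symcl)
qed

lemma connected_imp_cut_connected:
  assumes G: "pair_graph G" and conn: "Digraph_Component.connected (with_proj G)"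
  shows "cut_connected (pverts G) (parcs G)"
  unfolding cut_connected_def
proof (intro allI impI)
  interpret simple_rel "pverts G" "parcs G"
    using G by (rule pair_graph_simple_rel)
  have symcl: "symcl (parcs G) = parcs G" using R_symD by (auto simp: symcl_def)
  fix S assume S: "S \<noteq> {}" "S \<subset> pverts G"
  then obtain u v where uv: "u \<in> S" "v \<in> pverts G" "v \<notin> S" by blast
  then have "(u, v) \<in> rtrancl_on (pverts G) (parcs G)"
    using conn S unfolding connected_conv by (auto simp: symcl)
  \<comment> \<open>Along the path from \<open>u\<close>, either the set \<open>S\<close> has not
    been left yet or a crossing arc has been met.\<close>
  then have "v \<in> S \<or> (\<exists>a\<in>S. \<exists>b\<in>pverts G - S. (a, b) \<in> parcs G)"
    by (induction rule: rtrancl_on_induct) (use uv(1) in auto)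
  then show "\<exists>a\<in>S. \<exists>b\<in>pverts G - S. (a, b) \<in> parcs G" using uv by blast
qed

lemma card_parcs:
  assumes "pair_graph G"
  shows "card (parcs G) = 2 * card (edge_set G)"
proof -
  interpret simple_rel "pverts G" "parcs G"
    using assms by (rule pair_graph_simple_rel)
  let ?f = "\<lambda>(x, y). {x, y}"
  have "card {p \<in> parcs G. ?f p = e} = 2" if e: "e \<in> edge_set G" for e
  proof -
    obtain p where "p \<in> parcs G" "e = ?f p"
      using e unfolding edge_set_def by blast
    then obtain x y where xy: "(x, y) \<in> parcs G" "e = {x, y}" by (cases p) simp
    have eq: "p \<in> {p \<in> parcs G. ?f p = e} \<longleftrightarrow> p \<in> {(x, y), (y, x)}" for p
    proof (cases p)
      case (Pair i j)
      show ?thesis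
        unfolding Pair xy(2) using xy(1) R_symD[OF xy(1)] by (simp add: doubleton_eq_iff) blast
    qed
    have "{p \<in> parcs G. ?f p = e} = {(x, y), (y, x)}" by (rule Set.set_eqI, rule eq)
    moreover have "(x, y) \<noteq> (y, x)" using xy(1) not_refl[of x] by auto
    ultimately show ?thesis by simp
  qed
  then have "(\<Sum>e\<in>edge_set G. card {p \<in> parcs G. ?f p = e}) = 2 * card (edge_set G)"
    by simp
  moreover have "(\<Sum>p\<in>parcs G. 1) = (\<Sum>e\<in>edge_set G. \<Sum>p\<in>{p \<in> parcs G. ?f p = e}. (1 :: nat))"
    unfolding edge_set_def by (rule sum.image_gen[OF finite_R])
  ultimately show ?thesis by simp
qed

text \<open>The minimum merges two alternatives: b_4 \<ge> 2 n - 8 with two triangles brings the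
  extra 16 / s^2, while b_4 \<ge> 2 n - 7 brings an extra 4.\<close>

lemma bicyclic_energy_bounds:
  fixes G :: "'a pair_pre_digraph" and m :: real
  assumes G: "G \<in> connected_graphs n (n + 1)"
  defines "s \<equiv> energy G / 2" and "m \<equiv> real n + 1"
  shows "0 \<le> s" and "m \<le> s ^ 2"
    and "n = 4 \<or> 8 \<le> n \<Longrightarrow> 4 * (2 * real n - 8) + min 4 (16 / s ^ 2) \<le> (s ^ 2 - m) ^ 2"
    and "5 \<le> n \<Longrightarrow> n \<le> 7 \<Longrightarrow> 4 * (3 * real n - 15) \<le> (s ^ 2 - m) ^ 2"
proof -
  have g: "pair_graph G" "card (pverts G) = n" "card (edge_set G) = n + 1"
    "Digraph_Component.connected (with_proj G)"
    using G by (auto simp: connected_graphs_def)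
  let ?V = "pverts G" and ?R = "parcs G"
  have R: "card ?R = 2 * card ?V + 2" using card_parcs[OF g(1)] g by simp
  have few: "few_closed_walks ?V ?R"
    using few_closed_walks_bicyclic[OF pair_graph_simple_rel[OF g(1)] connected_imp_cut_connected[OF g(1,4)] R] .
  interpret simple_rel ?V ?R using g(1) by (rule pair_graph_simple_rel)
  obtain vs where vs: "distinct vs" "set vs = ?V" using finite_distinct_list[OF finite_V] by blast
  obtain X where X: "energy G = (\<Sum>x\<in>#X. \<bar>x\<bar>)" "psum 1 X = 0" "psum 2 X = card ?R"
    "psum 3 X = walks3 ?V ?R" "psum 4 X = walks4 ?V ?R"
    using energy_power_sums[OF g(1) vs] .
  have "psum 2 X = 2 * m" using X(3) R g(2) by (simp add: m_def)
  note b = abs_sum_lower_bounds[OF X(2) this, folded X(1) s_def, unfolded X(4,5)]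
  have "0 \<le> (\<Sum>x\<in>#Y. \<bar>x\<bar>)" for Y :: "real multiset" by (induction Y) auto
  then show s0: "0 \<le> s" unfolding s_def X(1) by simp
  show ms: "m \<le> s ^ 2" by (rule b(1))
  define w3 w4 where "w3 = walks3 ?V ?R" and "w4 = walks4 ?V ?R"
  have few': "w4 + 4 * n \<le> 2 * n ^ 2 + 34 \<and> 12 \<le> w3 \<or> w4 + 4 * n \<le> 2 * n ^ 2 + 30 \<or>
     5 \<le> n \<and> w4 + 8 * n \<le> 2 * n ^ 2 + 62"
    using few unfolding few_closed_walks_def g(2) w3_def w4_def by blast
  have b2: "2 * m ^ 2 - real w4 \<le> (s ^ 2 - m) ^ 2"
    and b3: "12 \<le> w3 \<Longrightarrow> 8 \<le> 3 * s ^ 3 \<Longrightarrow> 2 * m ^ 2 - real w4 + 16 / s ^ 2 \<le> (s ^ 2 - m) ^ 2"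
    using b(2,3) unfolding w3_def w4_def by auto
  have mm: "2 * m ^ 2 = 2 * real n ^ 2 + 4 * real n + 2"
    by (simp add: m_def power2_eq_square algebra_simps)
  have cast: "real a \<le> real b" if "a \<le> b" for a b :: nat using that by simp
  show "4 * (2 * real n - 8) + min 4 (16 / s ^ 2) \<le> (s ^ 2 - m) ^ 2" if n: "n = 4 \<or> 8 \<le> n"
  proof -
    \<comment> \<open>The third alternative excludes n = 4, and for n \<ge> 8 it implies the second,
      since 3 n - 15 \<ge> 2 n - 7.\<close>
    have "w4 + 4 * n \<le> 2 * n ^ 2 + 34 \<and> 12 \<le> w3 \<or> w4 + 4 * n \<le> 2 * n ^ 2 + 30"
      using few' n by auto
    then show ?thesis
    proof
      assume w: "w4 + 4 * n \<le> 2 * n ^ 2 + 34 \<and> 12 \<le> w3"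
      \<comment> \<open>Since m \<ge> 5, this gives s \<ge> 2 and hence the side condition 8 \<le> 3
        s^3 of \<open>b3\<close>.\<close>
      have "2 ^ 2 \<le> s ^ 2" using ms n unfolding m_def by auto
      then have "2 \<le> s" using s0 by (rule power2_le_imp_le)
      then have "2 ^ 3 \<le> s ^ 3" by (intro power_mono) auto
      define z where "z = 16 / s ^ 2"
      have "2 * m ^ 2 - real w4 + z \<le> (s ^ 2 - m) ^ 2"
        using b3 w \<open>2 ^ 3 \<le> s ^ 3\<close> unfolding z_def by simp
      moreover have "real w4 + 4 * real n \<le> 2 * real n ^ 2 + 34"
        using cast[OF conjunct1[OF w]] by simp
      moreover have "min 4 z \<le> z" by simp
      ultimately show ?thesis using mm unfolding z_def[symmetric] by argo
    next
      assume w: "w4 + 4 * n \<le> 2 * n ^ 2 + 30"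
      then have "real w4 + 4 * real n \<le> 2 * real n ^ 2 + 30" using cast[OF w] by simp
      moreover have "min 4 (16 / s ^ 2) \<le> 4" by simp
      ultimately show ?thesis using mm b2 by argo
    qed
  qed
  show "4 * (3 * real n - 15) \<le> (s ^ 2 - m) ^ 2" if n: "5 \<le> n" "n \<le> 7"
  proof -
    \<comment> \<open>For n \<le> 7 the first two alternatives imply this as well, since 2 n - 8
      \<ge> 3 n - 15.\<close>
    have "w4 + 8 * n \<le> 2 * n ^ 2 + 62" using few' n by auto
    then have "real w4 + 8 * real n \<le> 2 * real n ^ 2 + 62" using cast[of "w4 + 8 * n" "2 * n ^ 2 + 62"] by simp
    then show ?thesis using mm b2 by argo
  qed
qed

section \<open>The graph S with two triangles sharing an edge\<close>

lemma S_graph_bicyclic: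
  "S_graph n (n + 1) = \<lparr>pverts = {0..<n}, parcs = ({0} \<times> {1..<n} \<union> {1} \<times> {2, 3}) \<union> ({0} \<times> {1..<n} \<union> {1} \<times> {2, 3})\<inverse>\<rparr>"
proof -
  have "{2..<2 + (n + 1 + 1 - n)} = {2, 3 :: nat}" by auto
  then show ?thesis unfolding S_graph_def Let_def by simp
qed

lemma S_graph_pair_graph:
  assumes n: "4 \<le> n"
  shows "pair_graph (S_graph n (n + 1))" "card (edge_set (S_graph n (n + 1))) = n + 1"
proof -
  let ?E = "{0} \<times> {1..<n} \<union> {1 :: nat} \<times> {2, 3}"
  have E: "i < j \<and> j < n" if "(i, j) \<in> ?E" for i j using that n by auto
  have "card ?E = card ({0 :: nat} \<times> {1..<n}) + card ({1 :: nat} \<times> {2, 3 :: nat})"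
    by (intro card_Un_disjoint) auto
  then have "card ?E = n + 1" using n by (simp add: card_cartesian_product)
  then show "pair_graph (S_graph n (n + 1))" "card (edge_set (S_graph n (n + 1))) = n + 1"
    unfolding S_graph_bicyclic using pair_graph_increasing[of ?E n, OF E] by auto
qed

lemma S_graph_mem:
  assumes n: "4 \<le> n"
  shows "S_graph n (n + 1) \<in> connected_graphs n (n + 1)"
proof -
  have "(0, v) \<in> (parcs (S_graph n (n + 1)))\<^sup>*" if "v \<in> pverts (S_graph n (n + 1))" for v
    using that unfolding S_graph_bicyclic by (cases "v = 0") (auto intro!: r_into_rtrancl)
  moreover have "0 \<in> pverts (S_graph n (n + 1))" using n unfolding S_graph_bicyclic by simp
  ultimately have "Digraph_Component.connected (with_proj (S_graph n (n + 1)))"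
    using connected_if_reachable_from[OF S_graph_pair_graph(1)[OF n]] by blast
  moreover have "card (pverts (S_graph n (n + 1))) = n" unfolding S_graph_bicyclic by simp
  ultimately show ?thesis
    using S_graph_pair_graph[OF n] by (simp only: connected_graphs_def mem_Collect_eq)
qed

lemma S_graph_energy:
  assumes n: "4 \<le> n"
  defines "s \<equiv> energy (S_graph n (n + 1)) / 2"
  shows "0 < s" "real n + 1 \<le> s ^ 2" "(s ^ 2 - (real n + 1)) ^ 2 = 4 * (2 * real n - 8) + 16 / s ^ 2"
proof -
  \<comment> \<open>The classes are the centre, the distinguished leaf, its two further neighbours,
    and the n - 4 pendant vertices.\<close>
  define cl where "cl = (\<lambda>i :: nat. if i = 0 then 0 else if i = 1 then 1 else if i < 4 then 2 else 3 :: nat)"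
  define r where "r = (\<lambda>k j :: nat. if k = 0 then 1 \<le> j else if k = 1 then j = 0 \<or> j = 2 \<or> j = 3
    else if k = (2 :: nat) then j < 2 else j = 0)"
  obtain w where w: "n = w + 4" using n by (metis add.commute le_Suc_ex)
  define Q where "Q = (\<lambda>k l. [[0, 1, 2, w], [1, 0, 2, 0], [1, 1, 0, 0], [1, 0, 0, 0]] ! k ! l :: nat)"
  have Q: "card {j. j < n \<and> r k j \<and> cl j = l} = Q k l" if "k < 4" "l < 4" for k l
  proof -
    have "{j. j < n \<and> r k j \<and> cl j = l} =
      [[{}, {1}, {2, 3}, {4..<n}], [{0}, {}, {2, 3}, {}], [{0}, {1}, {}, {}], [{0}, {}, {}, {}]] ! k ! l"
      using that n by (auto simp: less_Suc_eq eval_nat_numeral r_def cl_def split: if_splits)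
    then show ?thesis using that w by (auto simp: Q_def less_Suc_eq eval_nat_numeral)
  qed
  have cl: "cl i < 4" for i by (simp add: cl_def)
  have r: "(i, j) \<in> parcs (S_graph n (n + 1)) \<longleftrightarrow> r (cl i) j" if "i < n" "j < n" for i j
    using that n unfolding S_graph_bicyclic by (auto simp: r_def cl_def)
  \<comment> \<open>Here m = n + 1, the trace 12 of the cube comes from the two triangles, and c = 2
    w is b_4 = 2 n - 8.\<close>
  have e: "(\<Sum>i<4. Q i i) = 0"
      "(\<Sum>i<4. \<Sum>k<4. Q i k * Q k i) = 2 * (w + 5)"
      "(\<Sum>i<4. \<Sum>j<4. (\<Sum>k<4. Q i k * Q k j) * Q j i) = 3 * 4"
      "(\<Sum>i<4. \<Sum>j<4. (\<Sum>k<4. Q i k * Q k j) * (\<Sum>k<4. Q j k * Q k i)) + 4 * (2 * w) = 2 * (w + 5) ^ 2"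
    by (simp_all add: sum_lessThan_4 Q_def power2_eq_square algebra_simps)
  have "pverts (S_graph n (n + 1)) = {0..<n}" unfolding S_graph_bicyclic by simp
  note energy_four_classes[OF S_graph_pair_graph(1)[OF n] this cl r Q e, folded s_def]
  then show "0 < s" "real n + 1 \<le> s ^ 2" "(s ^ 2 - (real n + 1)) ^ 2 = 4 * (2 * real n - 8) + 16 / s ^ 2"
    unfolding w by (simp_all add: algebra_simps)
qed

section \<open>The bipartite graph B, a K_{2,3} with pendant vertices\<close>

lemma B_graph_bicyclic:
  "B_graph n (n + 1) = \<lparr>pverts = {0..<n}, parcs = ({0} \<times> {2..<n} \<union> {1} \<times> {2, 3, 4}) \<union> ({0} \<times> {2..<n} \<union> {1} \<times> {2, 3, 4})\<inverse>\<rparr>"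
proof -
  have "{2..<2 + (n + 1 + 2 - n)} = {2, 3, 4 :: nat}" by auto
  then show ?thesis unfolding B_graph_def Let_def by simp
qed

lemma B_graph_pair_graph:
  assumes n: "5 \<le> n"
  shows "pair_graph (B_graph n (n + 1))" "card (edge_set (B_graph n (n + 1))) = n + 1"
proof -
  let ?E = "{0} \<times> {2..<n} \<union> {1 :: nat} \<times> {2, 3, 4}"
  have E: "i < j \<and> j < n" if "(i, j) \<in> ?E" for i j using that n by auto
  have "card ?E = card ({0 :: nat} \<times> {2..<n}) + card ({1 :: nat} \<times> {2, 3, 4 :: nat})"
    by (intro card_Un_disjoint) auto
  then have "card ?E = n + 1" using n by (simp add: card_cartesian_product)
  then show "pair_graph (B_graph n (n + 1))" "card (edge_set (B_graph n (n + 1))) = n + 1"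
    unfolding B_graph_bicyclic using pair_graph_increasing[of ?E n, OF E] by auto
qed

lemma B_graph_mem:
  assumes n: "5 \<le> n"
  shows "B_graph n (n + 1) \<in> connected_graphs n (n + 1)"
proof -
  let ?R = "parcs (B_graph n (n + 1))"
  have adj: "(0, v) \<in> ?R" if "2 \<le> v" "v < n" for v
    using that unfolding B_graph_bicyclic by auto
  have "(2, 1) \<in> ?R" unfolding B_graph_bicyclic by auto
  moreover have "(0, 2) \<in> ?R" using adj[of 2] n by simp
  ultimately have one: "(0, 1) \<in> ?R\<^sup>*" by (meson r_into_rtrancl rtrancl.rtrancl_into_rtrancl)
  have "(0, v) \<in> ?R\<^sup>*" if "v \<in> pverts (B_graph n (n + 1))" for v
  proof -
    have "v < n" using that unfolding B_graph_bicyclic by simp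
    then consider "v = 0" | "v = 1" | "(0, v) \<in> ?R" using adj[of v] by linarith
    then show ?thesis by cases (use one in auto)
  qed
  moreover have "0 \<in> pverts (B_graph n (n + 1))" using n unfolding B_graph_bicyclic by simp
  ultimately have "Digraph_Component.connected (with_proj (B_graph n (n + 1)))"
    using connected_if_reachable_from[OF B_graph_pair_graph(1)[OF n]] by blast
  moreover have "card (pverts (B_graph n (n + 1))) = n" unfolding B_graph_bicyclic by simp
  ultimately show ?thesis
    using B_graph_pair_graph[OF n] by (simp only: connected_graphs_def mem_Collect_eq)
qed

lemma B_graph_energy:
  assumes n: "5 \<le> n"
  defines "s \<equiv> energy (B_graph n (n + 1)) / 2"
  shows "0 < s" "real n + 1 \<le> s ^ 2" "(s ^ 2 - (real n + 1)) ^ 2 = 4 * (3 * real n - 15)"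
proof -
  \<comment> \<open>The classes are a, b, their three common neighbours, and the n - 5 pendant
    vertices at a.\<close>
  define cl where "cl = (\<lambda>i :: nat. if i = 0 then 0 else if i = 1 then 1 else if i < 5 then 2 else 3 :: nat)"
  define r where "r = (\<lambda>k j :: nat. if k = 0 then 2 \<le> j else if k = 1 then j = 2 \<or> j = 3 \<or> j = 4
    else if k = (2 :: nat) then j < 2 else j = 0)"
  obtain w where w: "n = w + 5" using n by (metis add.commute le_Suc_ex)
  define Q where "Q = (\<lambda>k l. [[0, 0, 3, w], [0, 0, 3, 0], [1, 1, 0, 0], [1, 0, 0, 0]] ! k ! l :: nat)"
  have Q: "card {j. j < n \<and> r k j \<and> cl j = l} = Q k l" if "k < 4" "l < 4" for k l
  proof -
    have "{j. j < n \<and> r k j \<and> cl j = l} =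
      [[{}, {}, {2, 3, 4}, {5..<n}], [{}, {}, {2, 3, 4}, {}], [{0}, {1}, {}, {}], [{0}, {}, {}, {}]] ! k ! l"
      using that n by (auto simp: less_Suc_eq eval_nat_numeral r_def cl_def split: if_splits)
    then show ?thesis using that w by (auto simp: Q_def less_Suc_eq eval_nat_numeral)
  qed
  have cl: "cl i < 4" for i by (simp add: cl_def)
  have r: "(i, j) \<in> parcs (B_graph n (n + 1)) \<longleftrightarrow> r (cl i) j" if "i < n" "j < n" for i j
    using that n unfolding B_graph_bicyclic by (auto simp: r_def cl_def)
  \<comment> \<open>The cubic trace vanishes because the graph is bipartite, and c = 3 w is b_4 = 3
    n - 15.\<close>
  have e: "(\<Sum>i<4. Q i i) = 0"
      "(\<Sum>i<4. \<Sum>k<4. Q i k * Q k i) = 2 * (w + 6)"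
      "(\<Sum>i<4. \<Sum>j<4. (\<Sum>k<4. Q i k * Q k j) * Q j i) = 3 * 0"
      "(\<Sum>i<4. \<Sum>j<4. (\<Sum>k<4. Q i k * Q k j) * (\<Sum>k<4. Q j k * Q k i)) + 4 * (3 * w) = 2 * (w + 6) ^ 2"
    by (simp_all add: sum_lessThan_4 Q_def power2_eq_square algebra_simps)
  have "pverts (B_graph n (n + 1)) = {0..<n}" unfolding B_graph_bicyclic by simp
  note energy_four_classes[OF B_graph_pair_graph(1)[OF n] this cl r Q e, folded s_def]
  then show "0 < s" "real n + 1 \<le> s ^ 2" "(s ^ 2 - (real n + 1)) ^ 2 = 4 * (3 * real n - 15)"
    unfolding w by (simp_all add: algebra_simps)
qed

text \<open>The term 16 / s^2 decreases in \<open>s\<close>, so a smaller energy would only raise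
  the lower bound for \<open>G\<close>. With t^2 \<ge> m \<ge> 5 the equality for S has 16 / t^2
  \<le> 4, so it lies below both values in the minimum, which contradicts the monotonicity of (s^2 -
  m)^2 for s^2 \<ge> m.\<close>

lemma S_graph_energy_le:
  assumes n: "n = 4 \<or> 8 \<le> n" and G: "G \<in> connected_graphs n (n + 1)"
  shows "energy (S_graph n (n + 1)) \<le> energy G"
proof (rule ccontr)
  define m t s where "m = real n + 1" and "t = energy (S_graph n (n + 1)) / 2" and "s = energy G / 2"
  have n4: "4 \<le> n" using n by auto
  note S = S_graph_energy[OF n4, folded t_def m_def]
  note b = bicyclic_energy_bounds[OF G, folded s_def m_def]
  assume "\<not> energy (S_graph n (n + 1)) \<le> energy G"
  then have "s < t" by (simp add: s_def t_def)
  then have st: "s ^ 2 < t ^ 2" using b(1) by (intro power_strict_mono) auto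
  have m5: "5 \<le> m" using n4 by (simp add: m_def)
  have sp: "0 < s ^ 2" using b(2) m5 by linarith
  have "16 / t ^ 2 < 16 / s ^ 2" using st sp S(1) by (intro divide_strict_left_mono mult_pos_pos) auto
  moreover have "16 / t ^ 2 \<le> 4" using S(2) m5 by (simp add: divide_le_eq)
  ultimately have "16 / t ^ 2 \<le> min 4 (16 / s ^ 2)" by simp
  then have "(t ^ 2 - m) ^ 2 \<le> (s ^ 2 - m) ^ 2" using b(3)[OF n] S(3) by linarith
  moreover have "(s ^ 2 - m) ^ 2 < (t ^ 2 - m) ^ 2" using st b(2) by (intro power_strict_mono) auto
  ultimately show False by linarith
qed

lemma B_graph_energy_le:
  assumes n: "5 \<le> n" "n \<le> 7" and G: "G \<in> connected_graphs n (n + 1)"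
  shows "energy (B_graph n (n + 1)) \<le> energy G"
proof (rule ccontr)
  define m t s where "m = real n + 1" and "t = energy (B_graph n (n + 1)) / 2" and "s = energy G / 2"
  note B = B_graph_energy[OF n(1), folded t_def m_def]
  note b = bicyclic_energy_bounds[OF G, folded s_def m_def]
  assume "\<not> energy (B_graph n (n + 1)) \<le> energy G"
  then have "s < t" by (simp add: s_def t_def)
  then have "s ^ 2 < t ^ 2" using b(1) by (intro power_strict_mono) auto
  then have "(s ^ 2 - m) ^ 2 < (t ^ 2 - m) ^ 2" using b(2) by (intro power_strict_mono) auto
  then show False using b(4)[OF n] B(3) by linarith
qed

theorem theorem1p6:
  fixes n :: nat
  shows "(n = 4 \<or> n \<ge> 8 \<longrightarrow>
      S_graph n (n + 1) \<in> connected_graphs n (n + 1) \<and>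
      (\<forall>G \<in> (connected_graphs n (n + 1) :: 'a pair_pre_digraph set).
         energy (S_graph n (n + 1)) \<le> energy G)) \<and>
    (5 \<le> n \<and> n \<le> 7 \<longrightarrow>
      B_graph n (n + 1) \<in> connected_graphs n (n + 1) \<and>
      (\<forall>G \<in> (connected_graphs n (n + 1) :: 'a pair_pre_digraph set).
         energy (B_graph n (n + 1)) \<le> energy G))"
  using S_graph_mem[of n] B_graph_mem[of n] S_graph_energy_le[of n] B_graph_energy_le[of n] by auto

end
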